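(* Let $X$ be a nonzero separable Banach space with the $\lambda$-approximation property, $1\le\lambda<\infty$. There exists a family $\{v_j\}_{j\in\mathbb N}\subset X$ of norm one vectors such that for every $H\in\mathcal L\bigl(G_b^{k,\omega}(\mathbb R^n);X\bigr)$ there is a family of functions $\{h_j\}_{j\in\mathbb N}\subset C_b^{k,\omega}(\mathbb R^n)$ of norms $\le 32\cdot\lambda^2\cdot\|H\|$ such that for all $x\in\mathbb R^n$ and all $\alpha\in\mathbb Z_+^n$ with $|\alpha|\le k$, $$H(\delta_x^\alpha)=\sum_{j=1}^\infty D^\alpha h_j(x)\cdot v_j$$ (convergence in $X$).
   Context: Let $n\in\mathbb N$, $k\in\mathbb Z_+$, and let $\omega:(0,\infty)\to(0,\infty)$ be a modulus of continuity, meaning that (i) $\omega(t)$ and $t/\omega(t)$ are nondecreasing on $(0,\infty)$, and (ii) $\lim_{t\to0^+}\omega(t)=0$. All functions are real-valued, Banach spaces are real, and $\|\cdot\|$ on $\mathbb R^n$ is the Euclidean norm. $C_b^{k,\omega}(\mathbb R^n)$ is the Banach space of $f\in C^k(\mathbb R^n)$ with finite norm $\|f\|_{C_b^{k,\omega}(\mathbb R^n)}:=\max\bigl(\|f\|_{C_b^k(\mathbb R^n)},|f|_{C_b^{k,\omega}(\mathbb R^n)}\bigr)$, where $\|f\|_{C_b^k(\mathbb R^n)}:=\max_{|\alpha|\le k}\sup_{x}|D^\alpha f(x)|$ and $|f|_{C_b^{k,\omega}(\mathbb R^n)}:=\max_{|\alpha|=k}\sup_{x\neq y}\frac{|D^\alpha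 f(x)-D^\alpha f(y)|}{\omega(\|x-y\|)}$. For $x\in\mathbb R^n$ and $|\alpha|\le k$, $\delta_x^\alpha\in\bigl(C_b^{k,\omega}(\mathbb R^n)\bigr)^*$ is the functional $\delta_x^\alpha(f)=D^\alpha f(x)$. $G_b^{k,\omega}(\mathbb R^n)\subset\bigl(C_b^{k,\omega}(\mathbb R^n)\bigr)^*$ is the minimal closed subspace containing all $\delta_x^0$, $x\in\mathbb R^n$, with the induced norm; it contains all $\delta_x^\alpha$, $|\alpha|\le k$. $\mathcal L(X_1;X_2)$ is the Banach space of bounded linear operators $X_1\to X_2$ with the operator norm. A Banach space $X$ has the $\lambda$-approximation property if for every compact $K\subset X$ and every $\varepsilon>0$ there is a finite rank bounded linear operator $T:X\to X$ with $\|T\|\le\lambda$ and $\|Tx-x\|\le\varepsilon$ for all $x\in K$. *)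

theory Defs
  imports "HOL-Analysis.Analysis"
begin

section \<open>Partial derivatives and the classes \<open>C\<^sup>k\<close>\<close>

definition partial :: "'n::finite \<Rightarrow> (real^'n \<Rightarrow> real) \<Rightarrow> real^'n \<Rightarrow> real" where
  "partial i f x = deriv (\<lambda>t. f (x + t *\<^sub>R axis i 1)) 0"

(* f is of class C^(k+1) iff f is continuous, all its first order partial derivatives exist
   everywhere, and these are of class C^k. Hence all iterated partial derivatives of order at
   most k, taken in any order, exist and are continuous. *)
primrec C_k :: "nat \<Rightarrow> (real^'n::finite \<Rightarrow> real) \<Rightarrow> bool" where
  "C_k 0 f \<longleftrightarrow> continuous_on UNIV f"
| "C_k (Suc k) f \<longleftrightarrow> continuous_on UNIV f \<and>
     (\<forall>i. (\<forall>x. (\<lambda>t. f (x + t *\<^sub>R axis i 1)) field_differentiable at 0) \<and> C_k k (partial i f))"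

(* The index type 'n carries no order, so a fixed enumeration of the coordinates is chosen to give
   D^alpha = partial_{i1}^{alpha i1} ... partial_{in}^{alpha in} a meaning for every f. For
   |alpha| <= k and f of class C^k the enumeration does not matter (symmetry of derivatives). *)
definition coords :: "'n::finite list" where
  "coords = (SOME xs. distinct xs \<and> set xs = UNIV)"

lemma distinct_coords: "distinct (coords :: 'n::finite list)"
  and set_coords: "set (coords :: 'n::finite list) = UNIV"
proof -
  obtain xs :: "'n list" where "set xs = UNIV" "distinct xs"
    using finite_distinct_list[OF finite[of "UNIV :: 'n set"]] by blast
  then have "distinct (coords :: 'n list) \<and> set (coords :: 'n list) = UNIV"
    unfolding coords_def by (intro someI_ex[of "\<lambda>xs. distinct xs \<and> set xs = UNIV"]) blast
  then show "distinct (coords :: 'n list)" "set (coords :: 'n list) = UNIV"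
    by auto
qed

definition mi_order :: "('n::finite \<Rightarrow> nat) \<Rightarrow> nat" where
  "mi_order \<alpha> = (\<Sum>i\<in>UNIV. \<alpha> i)"

definition D :: "('n::finite \<Rightarrow> nat) \<Rightarrow> (real^'n \<Rightarrow> real) \<Rightarrow> real^'n \<Rightarrow> real" where
  "D \<alpha> f = foldr (\<lambda>i g. (partial i ^^ \<alpha> i) g) coords f"


section \<open>The spaces \<open>C_b^{k,\<omega>}\<close>\<close>

(* Only the values of omega on (0,infinity) matter. *)
definition modulus_of_continuity :: "(real \<Rightarrow> real) \<Rightarrow> bool" where
  "modulus_of_continuity \<omega> \<longleftrightarrow>
     (\<forall>t>0. \<omega> t > 0) \<and> mono_on {0<..} \<omega> \<and> mono_on {0<..} (\<lambda>t. t / \<omega> t) \<and>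
     (\<omega> \<longlongrightarrow> 0) (at_right 0)"

(* The norms are first defined with values in [0,infinity], so that finiteness of the norm can be
   stated; the suprema over multi-indices range over finite nonempty sets, i.e. are maxima. *)
definition Cb_enorm :: "nat \<Rightarrow> (real^'n::finite \<Rightarrow> real) \<Rightarrow> ennreal" where
  "Cb_enorm k f = (SUP \<alpha>\<in>{\<alpha>. mi_order \<alpha> \<le> k}. SUP x. ennreal \<bar>D \<alpha> f x\<bar>)"

definition Cbw_eseminorm :: "nat \<Rightarrow> (real \<Rightarrow> real) \<Rightarrow> (real^'n::finite \<Rightarrow> real) \<Rightarrow> ennreal" where
  "Cbw_eseminorm k \<omega> f =
     (SUP \<alpha>\<in>{\<alpha>. mi_order \<alpha> = k}. SUP (x, y)\<in>{(x, y). x \<noteq> y}.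
        ennreal (\<bar>D \<alpha> f x - D \<alpha> f y\<bar> / \<omega> (norm (x - y))))"

definition Cbw_enorm :: "nat \<Rightarrow> (real \<Rightarrow> real) \<Rightarrow> (real^'n::finite \<Rightarrow> real) \<Rightarrow> ennreal" where
  "Cbw_enorm k \<omega> f = max (Cb_enorm k f) (Cbw_eseminorm k \<omega> f)"

definition Cbw :: "nat \<Rightarrow> (real \<Rightarrow> real) \<Rightarrow> (real^'n::finite \<Rightarrow> real) set" where
  "Cbw k \<omega> = {f. C_k k f \<and> Cbw_enorm k \<omega> f < \<infinity>}"

definition Cbw_norm :: "nat \<Rightarrow> (real \<Rightarrow> real) \<Rightarrow> (real^'n::finite \<Rightarrow> real) \<Rightarrow> real" where
  "Cbw_norm k \<omega> f = enn2real (Cbw_enorm k \<omega> f)"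


section \<open>Bounded operators on normed spaces of functions\<close>

text \<open>
  A normed space of functions is given by its carrier \<open>V\<close> and its norm \<open>N\<close>; the vector space
  operations are pointwise. A bounded operator on it is a total function of which only the
  values on \<open>V\<close> matter.
\<close>

definition bounded_linear_on ::
  "('a \<Rightarrow> real) set \<Rightarrow> (('a \<Rightarrow> real) \<Rightarrow> real) \<Rightarrow> (('a \<Rightarrow> real) \<Rightarrow> 'x::real_normed_vector) \<Rightarrow> bool" where
  "bounded_linear_on V N T \<longleftrightarrow>
     (\<forall>f\<in>V. \<forall>g\<in>V. T (\<lambda>a. f a + g a) = T f + T g) \<and>
     (\<forall>c. \<forall>f\<in>V. T (\<lambda>a. c * f a) = c *\<^sub>R T f) \<and>
     (\<exists>K. \<forall>f\<in>V. norm (T f) \<le> K * N f)"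

definition op_norm ::
  "('a \<Rightarrow> real) set \<Rightarrow> (('a \<Rightarrow> real) \<Rightarrow> real) \<Rightarrow> (('a \<Rightarrow> real) \<Rightarrow> 'x::real_normed_vector) \<Rightarrow> real" where
  "op_norm V N T = (SUP f\<in>{f\<in>V. N f \<le> 1}. norm (T f))"

(* Functionals are normalised to vanish off V, so that two elements of the dual space are equal
   iff they agree on V, and the dual is again a space of functions with pointwise operations. *)
definition dual_space ::
  "('a \<Rightarrow> real) set \<Rightarrow> (('a \<Rightarrow> real) \<Rightarrow> real) \<Rightarrow> (('a \<Rightarrow> real) \<Rightarrow> real) set" where
  "dual_space V N = {\<phi>. bounded_linear_on V N \<phi> \<and> (\<forall>f. f \<notin> V \<longrightarrow> \<phi> f = 0)}"

definition closed_subspace ::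
  "('a \<Rightarrow> real) set \<Rightarrow> (('a \<Rightarrow> real) \<Rightarrow> real) \<Rightarrow> ('a \<Rightarrow> real) set \<Rightarrow> bool" where
  "closed_subspace V N S \<longleftrightarrow>
     S \<subseteq> V \<and> (\<lambda>_. 0) \<in> S \<and>
     (\<forall>f\<in>S. \<forall>g\<in>S. (\<lambda>a. f a + g a) \<in> S) \<and>
     (\<forall>c. \<forall>f\<in>S. (\<lambda>a. c * f a) \<in> S) \<and>
     (\<forall>s. \<forall>f\<in>V. (\<forall>m::nat. s m \<in> S) \<and> (\<lambda>m. N (\<lambda>a. s m a - f a)) \<longlonglongrightarrow> 0 \<longrightarrow> f \<in> S)"


section \<open>The spaces \<open>G_b^{k,\<omega>}\<close>\<close>

definition delta ::
  "nat \<Rightarrow> (real \<Rightarrow> real) \<Rightarrow> ('n::finite \<Rightarrow> nat) \<Rightarrow> real^'n \<Rightarrow> (real^'n \<Rightarrow> real) \<Rightarrow> real" where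
  "delta k \<omega> \<alpha> x f = (if f \<in> Cbw k \<omega> then D \<alpha> f x else 0)"

abbreviation Cbw_dual :: "nat \<Rightarrow> (real \<Rightarrow> real) \<Rightarrow> ((real^'n::finite \<Rightarrow> real) \<Rightarrow> real) set" where
  "Cbw_dual k \<omega> \<equiv> dual_space (Cbw k \<omega>) (Cbw_norm k \<omega>)"

abbreviation Cbw_dual_norm :: "nat \<Rightarrow> (real \<Rightarrow> real) \<Rightarrow> ((real^'n::finite \<Rightarrow> real) \<Rightarrow> real) \<Rightarrow> real" where
  "Cbw_dual_norm k \<omega> \<equiv> op_norm (Cbw k \<omega>) (Cbw_norm k \<omega>)"

definition Gbw :: "nat \<Rightarrow> (real \<Rightarrow> real) \<Rightarrow> ((real^'n::finite \<Rightarrow> real) \<Rightarrow> real) set" where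
  "Gbw k \<omega> = closed_subspace (Cbw_dual k \<omega>) (Cbw_dual_norm k \<omega>) hull range (delta k \<omega> (\<lambda>_. 0))"


section \<open>The approximation property\<close>

definition finite_rank :: "('x::real_normed_vector \<Rightarrow>\<^sub>L 'y::real_normed_vector) \<Rightarrow> bool" where
  "finite_rank T \<longleftrightarrow> (\<exists>B. finite B \<and> range (blinfun_apply T) \<subseteq> span B)"

definition approximation_property :: "real \<Rightarrow> 'x::banach itself \<Rightarrow> bool" where
  "approximation_property lam _ \<longleftrightarrow>
     (\<forall>K::'x set. compact K \<longrightarrow> (\<forall>\<epsilon>>0. \<exists>T :: 'x \<Rightarrow>\<^sub>L 'x.
        finite_rank T \<and> norm T \<le> lam \<and> (\<forall>x\<in>K. norm (blinfun_apply T x - x) \<le> \<epsilon>)))"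

end

theory Submission
  imports Defs "HOL-Library.Multiset"
begin

text \<open>
  A bounded operator \<open>H\<close> on the predual is determined by the \<open>X\<close>-valued function
  \<open>x \<mapsto> H(\<delta>\<^sub>x)\<close>, and this function is as smooth as the members of the function space. Expanding its
  values in \<open>X\<close> therefore gives the series, as soon as \<open>X\<close> has a good system for expansions.

  The system is a frame: unit vectors \<open>v j\<close> and functionals \<open>g j\<close> of norm at most \<open>2 \<lambda>\<close> such that
  \<open>y = (\<Sum>j. g j y *\<^sub>R v j)\<close> for every \<open>y\<close> (\<open>approximation_property_imp_frame\<close>). By separability, the
  approximation property yields finite rank operators \<open>T n\<close> of norm at most \<open>\<lambda>\<close> that converge
  strongly to the identity, so \<open>y\<close> is the sum of the increments \<open>(T (n+1) - T n) y\<close>. Writing an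
  increment as a sum of rank one operators could make intermediate partial sums large. A trick of
  Pelczynski avoids this: the sum is divided by a large \<open>N\<close> and repeated \<open>N\<close> times, so that a partial
  sum is a fraction of the whole increment plus a small remainder, and the increments tend to zero.

  It remains to see that \<open>h j x = g j (H(\<delta>\<^sub>x))\<close> has the required smoothness
  (\<open>functional_of_deltas\<close>). Since all functions in the unit ball have highest order derivatives with the
  common modulus of continuity \<open>\<omega>\<close>, and bounded hence Lipschitz derivatives of lower order, the
  difference quotients of \<open>x \<mapsto> \<delta>\<^sub>x\<^sup>\<alpha>\<close> converge in the dual norm
  (\<open>dual_norm_delta_quotient_le\<close>). Consequently \<open>\<delta>\<^sub>x\<^sup>\<alpha>\<close> lies in the predual, and
  any bounded functional may be interchanged with differentiation. The norm of \<open>h j\<close> is at most that of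
  the functional \<open>g j \<circ> H\<close>, because \<open>\<delta>\<^sub>x\<^sup>\<alpha>\<close> has norm at most one and
  \<open>\<delta>\<^sub>x\<^sup>\<alpha> - \<delta>\<^sub>y\<^sup>\<alpha>\<close> has norm at most \<open>\<omega>(\<parallel>x - y\<parallel>)\<close> in the highest order.

  Every derivative of \<open>h j\<close>, in any order of differentiation, is needed for membership in the class
  \<open>C\<^sup>k\<close>, whereas the norm only sees the derivatives taken in one chosen order of the coordinates.
  The two are reconciled by the symmetry of mixed derivatives (\<open>iter_partial_eq_D\<close>). The resulting
  bound \<open>2 \<lambda> \<parallel>H\<parallel>\<close> is below the one claimed since \<open>\<lambda> \<ge> 1\<close>.
\<close>

section \<open>Expansions in Banach spaces with the approximation property\<close>

text \<open>
  Bounded coordinates turn convergence of vectors into convergence of their coefficients.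
\<close>
lemma closed_span_if_coordinates_bounded:
  fixes B :: "'a::real_normed_vector set"
  assumes "finite B" and C: "\<And>c. (\<Sum>b\<in>B. \<bar>c b\<bar>) \<le> C * norm (\<Sum>b\<in>B. c b *\<^sub>R b)"
  shows "closed (span B)"
  unfolding closed_sequential_limits
proof (intro allI impI, elim conjE)
  fix y l assume y: "\<forall>n. y n \<in> span B" and lim: "y \<longlonglongrightarrow> l"
  have "\<forall>n. \<exists>c. y n = (\<Sum>b\<in>B. c b *\<^sub>R b)"
    using y \<open>finite B\<close> by (auto simp: span_finite)
  then obtain c where c: "y n = (\<Sum>b\<in>B. c n b *\<^sub>R b)" for n by metis
  have "convergent (\<lambda>n. c n b)" if "b \<in> B" for b
  proof -
    have "Cauchy y" using lim LIMSEQ_imp_Cauchy by blast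
    then have "Cauchy (\<lambda>n. \<bar>C\<bar> *\<^sub>R y n)"
      by (intro bounded_linear.Cauchy[OF bounded_linear_scaleR_right])
    moreover have "dist (c m b) (c n b) \<le> dist (\<bar>C\<bar> *\<^sub>R y m) (\<bar>C\<bar> *\<^sub>R y n)" for m n
    proof -
      have "\<bar>c m b - c n b\<bar> \<le> (\<Sum>b\<in>B. \<bar>c m b - c n b\<bar>)"
        by (rule member_le_sum[OF that _ \<open>finite B\<close>]) auto
      also have "\<dots> \<le> C * norm (y m - y n)"
        using C[of "\<lambda>b. c m b - c n b"] by (simp add: c scaleR_diff_left sum_subtractf)
      also have "\<dots> \<le> \<bar>C\<bar> * norm (y m - y n)"
        by (intro mult_right_mono) auto
      finally show ?thesis
        by (simp add: dist_norm flip: scaleR_diff_right)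
    qed
    ultimately have "Cauchy (\<lambda>n. c n b)"
      unfolding Cauchy_def by (meson le_less_trans)
    then show ?thesis by (simp add: Cauchy_convergent_iff)
  qed
  then obtain c' where c': "\<And>b. b \<in> B \<Longrightarrow> (\<lambda>n. c n b) \<longlonglongrightarrow> c' b"
    unfolding convergent_def by metis
  have "y \<longlonglongrightarrow> (\<Sum>b\<in>B. c' b *\<^sub>R b)"
    unfolding c by (intro tendsto_sum tendsto_scaleR c' tendsto_const)
  then have "l = (\<Sum>b\<in>B. c' b *\<^sub>R b)"
    using lim LIMSEQ_unique by blast
  then show "l \<in> span B"
    by (auto intro: span_sum span_scale span_base)
qed

text \<open>
  By induction on the basis: the span of the previous vectors is closed, so the new vector
  has positive distance \<open>d\<close> from it, and its coefficient is at most \<open>1/d\<close> times the norm of the whole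
  combination. What remains is a combination of the previous vectors.
\<close>
lemma coordinates_bounded:
  fixes B :: "'a::real_normed_vector set"
  assumes "finite B" "independent B"
  shows "\<exists>C\<ge>0. \<forall>c. (\<Sum>b\<in>B. \<bar>c b\<bar>) \<le> C * norm (\<Sum>b\<in>B. c b *\<^sub>R b)"
  using assms
proof (induction B)
  case empty
  show ?case by auto
next
  case (insert a B)
  have ind: "independent B" "a \<notin> span B"
    using insert.prems insert.hyps by (auto simp: independent_insert)
  obtain C where "C \<ge> 0" and C: "\<And>c. (\<Sum>b\<in>B. \<bar>c b\<bar>) \<le> C * norm (\<Sum>b\<in>B. c b *\<^sub>R b)"
    using insert.IH[OF ind(1)] by blast
  have "closed (span B)"
    by (rule closed_span_if_coordinates_bounded[OF insert.hyps(1) C])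
  define d where "d = infdist a (span B)"
  have "span B \<noteq> {}" using span_zero by auto
  then have "d > 0"
    using in_closed_iff_infdist_zero[OF \<open>closed (span B)\<close>] ind(2) infdist_nonneg[of a "span B"]
    unfolding d_def by (metis less_eq_real_def)
  \<comment> \<open>The first summand bounds the coefficient of \<open>a\<close>; removing the multiple of \<open>a\<close> changes the norm of the
    combination by at most the factor \<open>1 + norm a / d\<close>, to which the constant \<open>C\<close> is applied.\<close>
  have "(\<Sum>b\<in>insert a B. \<bar>c b\<bar>) \<le> (1/d + C * (1 + norm a / d)) * norm (\<Sum>b\<in>insert a B. c b *\<^sub>R b)" for c
  proof -
    define s where "s = (\<Sum>b\<in>B. c b *\<^sub>R b)"
    define r where "r = norm (c a *\<^sub>R a + s)"
    have "\<bar>c a\<bar> * d \<le> r"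
    proof (cases "c a = 0")
      case False
      have "- (1 / c a) *\<^sub>R s \<in> span B"
        unfolding s_def by (intro span_scale span_sum) (auto intro: span_base)
      then have "d \<le> dist a (- (1 / c a) *\<^sub>R s)"
        unfolding d_def by (rule infdist_le)
      then have "\<bar>c a\<bar> * d \<le> \<bar>c a\<bar> * norm (a + (1 / c a) *\<^sub>R s)"
        by (intro mult_left_mono) (auto simp: dist_norm)
      also have "\<dots> = norm (c a *\<^sub>R (a + (1 / c a) *\<^sub>R s))" by simp
      also have "\<dots> = r" using False by (simp add: r_def scaleR_add_right)
      finally show ?thesis .
    qed (simp add: r_def)
    then have ca: "\<bar>c a\<bar> \<le> r / d" using \<open>d > 0\<close> by (simp add: field_simps)
    have "norm s \<le> r + \<bar>c a\<bar> * norm a"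
      using norm_triangle_ineq4[of "c a *\<^sub>R a + s" "c a *\<^sub>R a"] by (simp add: r_def)
    also have "\<dots> \<le> r + r / d * norm a"
      using ca by (intro add_left_mono mult_right_mono) auto
    finally have "C * norm s \<le> C * (r + r / d * norm a)"
      using \<open>C \<ge> 0\<close> by (rule mult_left_mono)
    then have "\<bar>c a\<bar> + (\<Sum>b\<in>B. \<bar>c b\<bar>) \<le> r / d + C * (r + r / d * norm a)"
      using C[of c] ca by (simp add: s_def)
    also have "\<dots> = (1/d + C * (1 + norm a / d)) * r"
      by (simp add: algebra_simps)
    finally show ?thesis
      using insert.hyps by (simp add: r_def s_def)
  qed
  moreover have "1/d + C * (1 + norm a / d) \<ge> 0"
    using \<open>C \<ge> 0\<close> \<open>d > 0\<close> by auto
  ultimately show ?case by blast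
qed

text \<open>
  A pair \<open>(g, e)\<close> stands for the rank one operator \<open>y \<mapsto> g y *\<^sub>R e\<close>. The order of
  the list matters, since partial sums have to be controlled.
\<close>
definition rank_one_sum :: "(('x \<Rightarrow> real) \<times> 'x) list \<Rightarrow> 'x \<Rightarrow> 'x::real_vector" where
  "rank_one_sum L x = (\<Sum>(g, e)\<leftarrow>L. g x *\<^sub>R e)"

lemma rank_one_sum_simps [simp]:
  "rank_one_sum [] x = 0"
  "rank_one_sum (p # L) x = fst p x *\<^sub>R snd p + rank_one_sum L x"
  "rank_one_sum (L @ L') x = rank_one_sum L x + rank_one_sum L' x"
  by (simp_all add: rank_one_sum_def case_prod_beta)

lemma rank_one_sum_concat_replicate:
  "rank_one_sum (concat (replicate N L)) x = real N *\<^sub>R rank_one_sum L x"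
  by (induction N) (auto simp: scaleR_add_left)

lemma norm_rank_one_sum_take_concat_replicate:
  assumes "\<And>p. norm (rank_one_sum (take p L) x) \<le> d"
  shows "norm (rank_one_sum (take p (concat (replicate N L))) x) \<le> real N * norm (rank_one_sum L x) + d"
proof (induction N arbitrary: p)
  case 0
  then show ?case using assms[of 0] by simp
next
  case (Suc N)
  show ?case
  proof (cases "p \<le> length L")
    case True
    then show ?thesis using assms[of p] by (simp add: add_increasing)
  next
    case False
    then show ?thesis
      using norm_triangle_ineq[of "rank_one_sum L x" "rank_one_sum (take (p - length L) (concat (replicate N L))) x"]
        Suc.IH[of "p - length L"]
      by (simp add: algebra_simps)
  qed
qed

lemma norm_rank_one_sum_take_le:
  assumes "\<forall>(g, e)\<in>set L. norm e = 1"
  shows "norm (rank_one_sum (take p L) x) \<le> (\<Sum>(g, e)\<leftarrow>L. \<bar>g x\<bar>)"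
  using assms
proof (induction L arbitrary: p)
  case (Cons q L)
  obtain g e where q: "q = (g, e)" by force
  show ?case
  proof (cases p)
    case 0
    have "(\<Sum>(g, e)\<leftarrow>L. \<bar>g x\<bar>) \<ge> 0" by (rule sum_list_nonneg) auto
    then show ?thesis using 0 by (simp add: q)
  next
    case (Suc p')
    have "norm (rank_one_sum (take p' L) x) \<le> (\<Sum>(g, e)\<leftarrow>L. \<bar>g x\<bar>)"
      using Cons by auto
    moreover have "norm e = 1" using Cons.prems q by auto
    ultimately show ?thesis
      using norm_triangle_ineq[of "g x *\<^sub>R e" "rank_one_sum (take p' L) x"]
      by (simp add: Suc q)
  qed
qed simp

text \<open>
  The functionals are the coordinates of \<open>S x\<close> in a normalised basis of a finite-dimensional
  space that contains the range of \<open>S\<close>. Bounding them by \<open>S x\<close> rather than by \<open>x\<close> makes them small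
  where \<open>S x\<close> is small.
\<close>
lemma finite_rank_rank_one_decomposition:
  fixes S :: "'x::real_normed_vector \<Rightarrow> 'x"
  assumes S: "bounded_linear S" and fin: "finite B" "range S \<subseteq> span B"
  shows "\<exists>L C. (\<forall>(g, e)\<in>set L. linear g \<and> norm e = 1) \<and> 0 \<le> C \<and>
    (\<forall>x. rank_one_sum L x = S x \<and> (\<Sum>(g, e)\<leftarrow>L. \<bar>g x\<bar>) \<le> C * norm (S x))"
proof -
  obtain B' where B': "B' \<subseteq> B" "independent B'" "span B' = span B"
    using maximal_independent_subset[of B]
    by (metis basis_exists fin(1) span_superset span_eq span_mono span_subspace subspace_span)
  have "finite B'" using fin(1) B' finite_subset by blast
  then obtain bs where bs: "set bs = B'" "distinct bs"
    using finite_distinct_list by blast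
  obtain C where "C \<ge> 0" and C: "\<And>c. (\<Sum>b\<in>B'. \<bar>c b\<bar>) \<le> C * norm (\<Sum>b\<in>B'. c b *\<^sub>R b)"
    using coordinates_bounded[OF \<open>finite B'\<close> B'(2)] by blast
  define c where "c b x = representation B' (S x) b" for b x
  have Sx: "S x \<in> span B'" for x using fin B' by auto
  have Sc: "(\<Sum>b\<in>B'. c b x *\<^sub>R b) = S x" for x
    unfolding c_def by (rule sum_representation_eq[OF B'(2) Sx \<open>finite B'\<close>]) simp
  have lin: "linear (c b)" for b
  proof (rule linearI)
    fix x y r
    show "c b (x + y) = c b x + c b y"
      unfolding c_def linear_add[OF bounded_linear.linear[OF S]]
      by (simp add: representation_add[OF B'(2) Sx Sx])
    show "c b (r *\<^sub>R x) = r *\<^sub>R c b x"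
      unfolding c_def linear_scale[OF bounded_linear.linear[OF S]]
      by (simp add: representation_scale[OF B'(2) Sx])
  qed
  have nz: "b \<noteq> 0" if "b \<in> B'" for b
    using that B'(2) dependent_zero by blast
  define L where "L = map (\<lambda>b. (\<lambda>x. norm b * c b x, b /\<^sub>R norm b)) bs"
  define C' where "C' = C * (\<Sum>b\<in>B'. norm b)"
  have "linear (\<lambda>x. norm b * c b x)" for b
    using linear_compose_scale_right[OF lin[of b], of "norm b"] by simp
  then have "\<forall>(g, e)\<in>set L. linear g \<and> norm e = 1"
    using nz bs by (auto simp: L_def)
  moreover have "rank_one_sum L x = S x" for x
  proof -
    have "rank_one_sum L x = (\<Sum>b\<leftarrow>bs. c b x *\<^sub>R b)"
      unfolding L_def rank_one_sum_def using nz bs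
      by (auto simp: o_def intro!: arg_cong[where f=sum_list] map_cong)
    then show ?thesis using Sc[of x] bs by (simp add: sum_list_distinct_conv_sum_set)
  qed
  moreover have "(\<Sum>(g, e)\<leftarrow>L. \<bar>g x\<bar>) \<le> C' * norm (S x)" for x
  proof -
    have "(\<Sum>(g, e)\<leftarrow>L. \<bar>g x\<bar>) = (\<Sum>b\<in>B'. norm b * \<bar>c b x\<bar>)"
      unfolding L_def using bs by (simp add: o_def abs_mult sum_list_distinct_conv_sum_set)
    also have "\<dots> \<le> (\<Sum>b\<in>B'. norm b * (C * norm (S x)))"
    proof (intro sum_mono mult_left_mono)
      fix b assume "b \<in> B'"
      then have "\<bar>c b x\<bar> \<le> (\<Sum>b\<in>B'. \<bar>c b x\<bar>)"
        using \<open>finite B'\<close> by (intro member_le_sum) auto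
      then show "\<bar>c b x\<bar> \<le> C * norm (S x)" using C[of "\<lambda>b. c b x"] Sc[of x] by simp
    qed auto
    also have "\<dots> = C' * norm (S x)" by (simp add: C'_def sum_distrib_left sum_distrib_right algebra_simps)
    finally show ?thesis .
  qed
  moreover have "0 \<le> C'" using \<open>C \<ge> 0\<close> by (auto simp: C'_def intro!: mult_nonneg_nonneg sum_nonneg)
  ultimately show ?thesis by blast
qed

text \<open>
  Pelczynski's averaging trick: the rank one decomposition of \<open>S\<close>, divided by \<open>N\<close>, is repeated
  \<open>N\<close> times. After \<open>q\<close> full rounds the partial sum is \<open>(q/N) S x\<close>, and a further incomplete round
  contributes at most \<open>(C/N) \<parallel>S x\<parallel>\<close>, where \<open>C\<close> may be as large as the basis requires but \<open>N \<ge> C\<close>. The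
  pair \<open>(0, u)\<close> is put in front so that the list is nonempty even for \<open>S = 0\<close>, which allows infinitely
  many such lists to be concatenated to a sequence.
\<close>
lemma finite_rank_balanced_decomposition:
  fixes S :: "'x::real_normed_vector \<Rightarrow> 'x" and u :: 'x
  assumes S: "bounded_linear S" and fin: "finite B" "range S \<subseteq> span B"
    and u: "norm u = 1"
  shows "\<exists>L. L \<noteq> [] \<and> (\<forall>(g, e)\<in>set L. linear g \<and> (\<forall>x. \<bar>g x\<bar> \<le> norm (S x)) \<and> norm e = 1) \<and>
    (\<forall>x. rank_one_sum L x = S x \<and> (\<forall>p. norm (rank_one_sum (take p L) x) \<le> 2 * norm (S x)))"
proof -
  obtain L C where L: "\<forall>(g, e)\<in>set L. linear g \<and> norm e = 1" and "0 \<le> C"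
    and sum: "\<And>x. rank_one_sum L x = S x"
    and bound: "\<And>x. (\<Sum>(g, e)\<leftarrow>L. \<bar>g x\<bar>) \<le> C * norm (S x)"
    using finite_rank_rank_one_decomposition[OF S fin] by blast
  obtain N :: nat where "C < N" using reals_Archimedean2 by blast
  then have N: "C / N \<le> 1" "0 < N" using \<open>0 \<le> C\<close> by auto
  define L' where "L' = (\<lambda>_. 0, u) # map (\<lambda>(g, e). (\<lambda>x. g x / N, e)) L"
  have L': "\<forall>(g, e)\<in>set L'. linear g \<and> norm e = 1"
    using L u by (auto simp: L'_def linear_iff add_divide_distrib)
  have sum_map: "rank_one_sum (map (\<lambda>(g, e). (\<lambda>x. g x / N, e)) M) x = rank_one_sum M x /\<^sub>R N" for M x
    by (induction M) (auto simp: scaleR_add_right divide_inverse_commute)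
  have sum': "rank_one_sum L' x = S x /\<^sub>R N" for x
    by (simp add: L'_def sum_map sum)
  have bound': "(\<Sum>(g, e)\<leftarrow>L'. \<bar>g x\<bar>) \<le> norm (S x)" for x
  proof -
    have "(\<Sum>(g, e)\<leftarrow>map (\<lambda>(g, e). (\<lambda>x. g x / N, e)) M. \<bar>g x\<bar>) = (\<Sum>(g, e)\<leftarrow>M. \<bar>g x\<bar>) / N"
      for M :: "(('x \<Rightarrow> real) \<times> 'x) list"
      by (induction M) (auto simp: add_divide_distrib)
    then have "(\<Sum>(g, e)\<leftarrow>L'. \<bar>g x\<bar>) = (\<Sum>(g, e)\<leftarrow>L. \<bar>g x\<bar>) / N"
      by (simp add: L'_def)
    also have "\<dots> \<le> C * norm (S x) / N" using bound by (intro divide_right_mono) auto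
    also have "\<dots> \<le> 1 * norm (S x)" using mult_right_mono[OF N(1), of "norm (S x)"] by simp
    finally show ?thesis by simp
  qed
  define M where "M = concat (replicate N L')"
  have setM: "set M = set L'" using N by (auto simp: M_def)
  have "\<bar>g x\<bar> \<le> norm (S x)" if "(g, e) \<in> set L'" for g e x
  proof -
    have "\<bar>g x\<bar> \<in> set (map (\<lambda>(g, e). \<bar>g x\<bar>) L')" using that by force
    then have "\<bar>g x\<bar> \<le> (\<Sum>(g, e)\<leftarrow>L'. \<bar>g x\<bar>)" by (rule member_le_sum_list) auto
    then show ?thesis using bound'[of x] by linarith
  qed
  then have "\<forall>(g, e)\<in>set M. linear g \<and> (\<forall>x. \<bar>g x\<bar> \<le> norm (S x)) \<and> norm e = 1"
    using L' unfolding setM by auto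
  moreover have "M \<noteq> []" using setM by (auto simp: L'_def)
  moreover have "rank_one_sum M x = S x" for x
    using N by (simp add: M_def rank_one_sum_concat_replicate sum')
  moreover have "norm (rank_one_sum (take p M) x) \<le> 2 * norm (S x)" for p x
  proof -
    have "norm (rank_one_sum (take p M) x) \<le> N * norm (rank_one_sum L' x) + norm (S x)"
      unfolding M_def
    proof (rule norm_rank_one_sum_take_concat_replicate)
      fix p
      show "norm (rank_one_sum (take p L') x) \<le> norm (S x)"
        using norm_rank_one_sum_take_le[of L' p x] L' bound'[of x] by fastforce
    qed
    moreover have "N * norm (rank_one_sum L' x) = norm (S x)"
      using N(2) by (simp add: sum' field_simps)
    ultimately show ?thesis by simp
  qed
  ultimately show ?thesis by blast
qed


text \<open>
  The infinite concatenation of the blocks. The sequence runs through the positions \<open>(n, p)\<close>,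
  where \<open>p\<close> is an index into block \<open>n\<close>; \<open>\<nu> m\<close> and \<open>\<pi> m\<close> are the position reached after \<open>m\<close> steps.
\<close>
lemma concatenation_of_blocks:
  fixes blk :: "nat \<Rightarrow> 'b list"
  assumes ne: "\<And>n. blk n \<noteq> []"
  shows "\<exists>q \<nu> \<pi>. (\<forall>j. \<exists>n. q j \<in> set (blk n)) \<and> filterlim \<nu> at_top sequentially \<and>
    (\<forall>m. map q [0..<m] = concat (map blk [0..<\<nu> m]) @ take (\<pi> m) (blk (\<nu> m)))"
proof -
  define step where "step = (\<lambda>(n, p). if Suc p < length (blk n) then (n, Suc p) else (Suc n, 0::nat))"
  define st where "st j = (step ^^ j) (0, 0)" for j
  define q where "q j = blk (fst (st j)) ! snd (st j)" for j
  have inv: "snd (st j) < length (blk (fst (st j)))" for j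
    by (induction j) (use ne in \<open>auto simp: st_def step_def case_prod_beta\<close>)
  have blocks: "map q [0..<m] = concat (map blk [0..<fst (st m)]) @ take (snd (st m)) (blk (fst (st m)))" for m
  proof (induction m)
    case 0
    then show ?case by (simp add: st_def)
  next
    case (Suc m)
    have st: "st (Suc m) = step (st m)" by (simp add: st_def)
    obtain n p where np: "st m = (n, p)" by force
    have p: "p < length (blk n)" using inv[of m] np by simp
    have "map q [0..<m] = concat (map blk [0..<n]) @ take p (blk n)"
      using Suc by (simp only: np fst_conv snd_conv)
    moreover have "q m = blk n ! p" by (simp add: q_def np)
    ultimately have "map q [0..<Suc m] = concat (map blk [0..<n]) @ take (Suc p) (blk n)"
      using p by (simp add: take_Suc_conv_app_nth)
    then show ?case using p by (auto simp: st np step_def)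
  qed
  have "filterlim (\<lambda>m. fst (st m)) at_top sequentially"
    unfolding filterlim_at_top eventually_sequentially
  proof
    fix N
    have "N \<le> fst (st m)" if "Suc (length (concat (map blk [0..<N]))) \<le> m" for m
    proof (rule ccontr)
      assume "\<not> N \<le> fst (st m)"
      then obtain d where N: "N = Suc (fst (st m)) + d"
        by (metis less_iff_Suc_add not_le add_Suc)
      have "length (map q [0..<m]) \<le> length (concat (map blk [0..<Suc (fst (st m))]))"
        unfolding blocks by simp
      also have "\<dots> \<le> length (concat (map blk [0..<N]))"
        unfolding N upt_add_eq_append[of 0, OF le0] by simp
      finally show False using that by simp
    qed
    then show "\<exists>M. \<forall>m\<ge>M. N \<le> fst (st m)" by blast
  qed
  moreover have "\<exists>n. q j \<in> set (blk n)" for j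
    unfolding q_def by (rule exI) (rule nth_mem[OF inv])
  ultimately show ?thesis
    using blocks
    by (intro exI[of _ q] exI[of _ "\<lambda>m. fst (st m)"] exI[of _ "\<lambda>m. snd (st m)"] conjI allI)
qed

text \<open>
  For a dense sequence \<open>d\<close>, the operator \<open>T n\<close> is chosen close to the identity on the compact set
  \<open>{d 0, ..., d (n - 1)}\<close>; the uniform norm bound extends the convergence from \<open>d\<close> to all points.
  Starting with \<open>T 0 = 0\<close> makes the increments telescope to \<open>T n\<close>.
\<close>
lemma approximation_property_imp_finite_rank_sequence:
  assumes sep: "separable_space (euclidean :: 'x topology)"
    and ap: "approximation_property lam TYPE('x::banach)"
  shows "\<exists>T :: nat \<Rightarrow> 'x \<Rightarrow>\<^sub>L 'x. T 0 = 0 \<and> (\<forall>n. finite_rank (T n) \<and> norm (T n) \<le> lam) \<and> (\<forall>x. (\<lambda>n. T n x) \<longlonglongrightarrow> x)"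
proof -
  obtain U :: "'x set" where U: "countable U" "closure U = UNIV"
    using sep by (auto simp: separable_space_def)
  then have "U \<noteq> {}" by auto
  define d where "d = from_nat_into U"
  have d: "range d = U" unfolding d_def using U \<open>U \<noteq> {}\<close> by (rule_tac range_from_nat_into)
  have ap': "\<exists>T :: 'x \<Rightarrow>\<^sub>L 'x. finite_rank T \<and> norm T \<le> lam \<and> (\<forall>x\<in>K. norm (T x - x) \<le> e)"
    if "compact K" "e > 0" for K :: "'x set" and e
    using ap that unfolding approximation_property_def by blast
  have "lam \<ge> 0" using ap'[of "{}" 1] by (auto intro: order_trans[OF norm_ge_zero])
  have "\<exists>T :: 'x \<Rightarrow>\<^sub>L 'x. (n = 0 \<longrightarrow> T = 0) \<and> finite_rank T \<and> norm T \<le> lam \<and>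
      (\<forall>x\<in>d ` {..<n}. norm (T x - x) \<le> inverse (real (Suc n)))" for n
  proof (cases "n = 0")
    case True
    have "finite_rank (0 :: 'x \<Rightarrow>\<^sub>L 'x)"
      unfolding finite_rank_def by (intro exI[of _ "{}"]) auto
    then show ?thesis using True \<open>lam \<ge> 0\<close> by (intro exI[of _ 0]) auto
  next
    case False
    then show ?thesis using ap'[of "d ` {..<n}" "inverse (real (Suc n))"] by (auto simp: finite_imp_compact)
  qed
  then obtain T :: "nat \<Rightarrow> 'x \<Rightarrow>\<^sub>L 'x" where T0: "T 0 = 0" and T: "\<And>n. finite_rank (T n)" "\<And>n. norm (T n) \<le> lam"
    "\<And>n i. i < n \<Longrightarrow> norm (T n (d i) - d i) \<le> inverse (real (Suc n))"
    by (metis image_eqI lessThan_iff)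
  have "(\<lambda>n. T n x) \<longlonglongrightarrow> x" for x
  proof (rule metric_LIMSEQ_I)
    fix e :: real assume "e > 0"
    \<comment> \<open>Replacing \<open>x\<close> by a point at distance \<open>\<delta>\<close> costs at most \<open>(lam + 1) * \<delta> = e / 2\<close>.\<close>
    define \<delta> where "\<delta> = e / (2 * (lam + 1))"
    have "\<delta> > 0" using \<open>e > 0\<close> \<open>lam \<ge> 0\<close> by (simp add: \<delta>_def)
    then obtain y where "y \<in> U" "dist y x < \<delta>"
      using U(2) closure_approachable by blast
    then obtain i where i: "norm (d i - x) < \<delta>" using d by (auto simp: dist_norm)
    obtain N where N: "inverse (real (Suc N)) < e / 2"
      using reals_Archimedean[of "e / 2"] \<open>e > 0\<close> by auto
    have "dist (T n x) x < e" if n: "n \<ge> max (Suc i) N" for n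
    proof -
      have "T n x - x = T n (x - d i) + (T n (d i) - d i) + (d i - x)"
        by (simp add: blinfun.diff_right)
      then have "norm (T n x - x) \<le> norm (T n (x - d i)) + norm (T n (d i) - d i) + norm (d i - x)"
        by (metis norm_triangle_le norm_triangle_ineq add_right_mono)
      also have "norm (T n (x - d i)) \<le> lam * norm (d i - x)"
        by (metis norm_blinfun norm_minus_commute mult_right_mono[OF T(2)] norm_ge_zero order_trans)
      also have "norm (T n (d i) - d i) \<le> inverse (real (Suc n))"
        using T(3) n by auto
      also have "inverse (real (Suc n)) \<le> inverse (real (Suc N))"
        using n by (simp add: le_imp_inverse_le)
      finally have "norm (T n x - x) < (lam + 1) * norm (d i - x) + e / 2"
        using N by (simp add: algebra_simps)
      also have "(lam + 1) * norm (d i - x) \<le> (lam + 1) * \<delta>"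
        using i \<open>lam \<ge> 0\<close> by (intro mult_left_mono) auto
      also have "(lam + 1) * \<delta> = e / 2" using \<open>lam \<ge> 0\<close> by (simp add: \<delta>_def field_simps)
      finally show ?thesis by (simp add: dist_norm)
    qed
    then show "\<exists>M. \<forall>n\<ge>M. dist (T n x) x < e" by blast
  qed
  then show ?thesis using T0 T by blast
qed

lemma finite_rank_diff:
  assumes "finite_rank S" "finite_rank T"
  shows "finite_rank (S - T)"
proof -
  obtain A B where "finite A" "range S \<subseteq> span A" "finite B" "range T \<subseteq> span B"
    using assms by (auto simp: finite_rank_def)
  then have "finite (A \<union> B)" "range (S - T) \<subseteq> span (A \<union> B)"
    by (auto simp: blinfun.diff_left intro!: span_diff)
      (meson UNIV_I image_eqI span_mono subsetD sup_ge1 sup_ge2)+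
  then show ?thesis unfolding finite_rank_def by blast
qed

lemma rank_one_sum_concat:
  "rank_one_sum (concat (map blk [0..<n])) x = (\<Sum>i<n. rank_one_sum (blk i) x)"
  by (induction n) auto

text \<open>
  The blocks are the balanced decompositions of the increments \<open>S n = T (n+1) - T n\<close>. A partial sum of
  the resulting sequence that ends within block \<open>n\<close> differs from \<open>T n x\<close> by at most \<open>2 \<parallel>S n x\<parallel>\<close>, which
  tends to zero because \<open>T n x\<close> converges. The constant \<open>2 \<lambda>\<close> is the bound for \<open>\<parallel>S n\<parallel>\<close>.
\<close>
lemma approximation_property_imp_frame:
  assumes nz: "\<exists>x::'x::banach. x \<noteq> 0"
    and sep: "separable_space (euclidean :: 'x topology)"
    and ap: "approximation_property lam TYPE('x)"
  shows "\<exists>(v :: nat \<Rightarrow> 'x) g. (\<forall>j. norm (v j) = 1 \<and> linear (g j) \<and> (\<forall>x. \<bar>g j x\<bar> \<le> 2 * lam * norm x)) \<and>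
    (\<forall>x. (\<lambda>j. g j x *\<^sub>R v j) sums x)"
proof -
  obtain T :: "nat \<Rightarrow> 'x \<Rightarrow>\<^sub>L 'x" where T0: "T 0 = 0" and T: "\<And>n. finite_rank (T n)" "\<And>n. norm (T n) \<le> lam"
    and lim: "\<And>x. (\<lambda>n. T n x) \<longlonglongrightarrow> x"
    using approximation_property_imp_finite_rank_sequence[OF sep ap] by blast
  define S where "S n = T (Suc n) - T n" for n
  obtain w :: 'x where "w \<noteq> 0" using nz by blast
  define u where "u = w /\<^sub>R norm w"
  have u: "norm u = 1" using \<open>w \<noteq> 0\<close> by (simp add: u_def)
  define balanced where "balanced n L \<longleftrightarrow>
    L \<noteq> [] \<and> (\<forall>(g, e)\<in>set L. linear g \<and> (\<forall>x. \<bar>g x\<bar> \<le> norm (S n x)) \<and> norm e = 1) \<and>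
    (\<forall>x. rank_one_sum L x = S n x \<and> (\<forall>p. norm (rank_one_sum (take p L) x) \<le> 2 * norm (S n x)))" for n L
  have "\<exists>L. balanced n L" for n
  proof -
    obtain B where "finite B" "range (S n) \<subseteq> span B"
      using finite_rank_diff[OF T(1)[of "Suc n"] T(1)[of n]] unfolding S_def finite_rank_def by blast
    then show ?thesis
      unfolding balanced_def
      using finite_rank_balanced_decomposition[OF blinfun.bounded_linear_right _ _ u] by blast
  qed
  then obtain blk where blk: "\<And>n. balanced n (blk n)" by metis
  have ne: "blk n \<noteq> []"
    and mem: "(g, e) \<in> set (blk n) \<Longrightarrow> linear g \<and> (\<forall>x. \<bar>g x\<bar> \<le> norm (S n x)) \<and> norm e = 1"
    and sum: "rank_one_sum (blk n) x = S n x"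
    and bound: "norm (rank_one_sum (take p (blk n)) x) \<le> 2 * norm (S n x)" for n g e p x
    using blk[of n] unfolding balanced_def by blast+
  obtain q \<nu> \<pi> where q: "\<And>j. \<exists>n. q j \<in> set (blk n)" and \<nu>: "filterlim \<nu> at_top sequentially"
    and part: "\<And>m. map q [0..<m] = concat (map blk [0..<\<nu> m]) @ take (\<pi> m) (blk (\<nu> m))"
    using concatenation_of_blocks[of blk, OF ne] by blast
  have "norm (S n x) \<le> 2 * lam * norm x" for n x
  proof -
    have "norm (S n) \<le> 2 * lam"
      unfolding S_def using norm_triangle_ineq4[of "T (Suc n)" "T n"] T(2)[of n] T(2)[of "Suc n"] by linarith
    then show ?thesis using norm_blinfun[of "S n" x] mult_right_mono[of "norm (S n)" "2 * lam" "norm x"] by simp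
  qed
  moreover have "\<exists>n. linear (fst (q j)) \<and> (\<forall>x. \<bar>fst (q j) x\<bar> \<le> norm (S n x)) \<and> norm (snd (q j)) = 1" for j
    using q[of j] mem by (metis prod.collapse)
  ultimately have 1: "norm (snd (q j)) = 1 \<and> linear (fst (q j)) \<and> (\<forall>x. \<bar>fst (q j) x\<bar> \<le> 2 * lam * norm x)" for j
    by (meson order_trans)
  have "(\<lambda>j. fst (q j) x *\<^sub>R snd (q j)) sums x" for x
    unfolding sums_def
  proof (rule Lim_transform)
    show "(\<lambda>m. T (\<nu> m) x) \<longlonglongrightarrow> x"
      by (rule filterlim_compose[OF lim \<nu>])
    have "(\<lambda>n. T (Suc n) x - T n x) \<longlonglongrightarrow> x - x"
      by (intro tendsto_diff lim LIMSEQ_Suc)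
    then have "(\<lambda>n. S n x) \<longlonglongrightarrow> 0" by (simp add: S_def blinfun.diff_left)
    then have "(\<lambda>n. 2 * norm (S n x)) \<longlonglongrightarrow> 0"
      using tendsto_mult_right_zero tendsto_norm_zero by blast
    then have S0: "(\<lambda>m. 2 * norm (S (\<nu> m) x)) \<longlonglongrightarrow> 0"
      by (rule filterlim_compose[OF _ \<nu>])
    have "(\<Sum>j<m. fst (q j) x *\<^sub>R snd (q j)) - T (\<nu> m) x = rank_one_sum (take (\<pi> m) (blk (\<nu> m))) x" for m
    proof -
      have "(\<Sum>j<m. fst (q j) x *\<^sub>R snd (q j)) = rank_one_sum (map q [0..<m]) x"
        by (induction m) auto
      also have "\<dots> = (\<Sum>i<\<nu> m. S i x) + rank_one_sum (take (\<pi> m) (blk (\<nu> m))) x"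
        unfolding part by (simp add: rank_one_sum_concat sum)
      also have "(\<Sum>i<\<nu> m. S i x) = T (\<nu> m) x"
        using sum_lessThan_telescope[of "\<lambda>i. T i x" "\<nu> m"] by (simp add: S_def blinfun.diff_left T0)
      finally show ?thesis by simp
    qed
    then have "norm ((\<Sum>j<m. fst (q j) x *\<^sub>R snd (q j)) - T (\<nu> m) x) \<le> 2 * norm (S (\<nu> m) x)" for m
      using bound by simp
    then show "(\<lambda>m. (\<Sum>j<m. fst (q j) x *\<^sub>R snd (q j)) - T (\<nu> m) x) \<longlonglongrightarrow> 0"
      by (intro Lim_null_comparison[OF always_eventually S0]) auto
  qed
  then show ?thesis
    using 1 by (intro exI[of _ "\<lambda>j. snd (q j)"] exI[of _ "\<lambda>j. fst (q j)"]) blast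
qed


section \<open>Iterated partial derivatives\<close>

lemma partial_has_derivative:
  assumes "\<And>x. (\<lambda>t. f (x + t *\<^sub>R axis i 1)) field_differentiable at 0"
  shows "((\<lambda>t. f (x + t *\<^sub>R axis i 1)) has_real_derivative partial i f (x + t *\<^sub>R axis i 1)) (at t)"
proof -
  let ?y = "x + t *\<^sub>R axis i 1"
  have "((\<lambda>s. f (?y + s *\<^sub>R axis i 1)) has_real_derivative partial i f ?y) (at 0)"
    unfolding partial_def using assms by (simp add: DERIV_deriv_iff_field_differentiable)
  then have "((\<lambda>s. f (x + (s + t) *\<^sub>R axis i 1)) has_real_derivative partial i f ?y) (at 0)"
    by (simp add: algebra_simps)
  then show ?thesis
    using DERIV_shift[of "\<lambda>s. f (x + s *\<^sub>R axis i 1)" "partial i f ?y" 0 t] by simp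
qed

text \<open>
  The mean value theorem, applied along \<open>a\<close> to the difference \<open>s \<mapsto> f (x + r b + s a) - f (x + s a)\<close>
  and then along \<open>b\<close>. The left-hand side is symmetric in \<open>a\<close> and \<open>b\<close>, which yields the symmetry of
  mixed derivatives.
\<close>
lemma mixed_difference_mean_value:
  fixes f fa fab :: "'a::real_vector \<Rightarrow> real"
  assumes fa: "\<And>x t. ((\<lambda>t. f (x + t *\<^sub>R a)) has_real_derivative fa (x + t *\<^sub>R a)) (at t)"
    and fab: "\<And>x t. ((\<lambda>t. fa (x + t *\<^sub>R b)) has_real_derivative fab (x + t *\<^sub>R b)) (at t)"
    and "r > 0"
  shows "\<exists>s t. 0 < s \<and> s < r \<and> 0 < t \<and> t < r \<and>
    f (x + r *\<^sub>R a + r *\<^sub>R b) - f (x + r *\<^sub>R a) - f (x + r *\<^sub>R b) + f x = r\<^sup>2 * fab (x + s *\<^sub>R a + t *\<^sub>R b)"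
proof -
  define u where "u s = f (x + r *\<^sub>R b + s *\<^sub>R a) - f (x + s *\<^sub>R a)" for s
  have "(u has_real_derivative fa (x + r *\<^sub>R b + s *\<^sub>R a) - fa (x + s *\<^sub>R a)) (at s)" for s
    unfolding u_def by (intro DERIV_diff fa)
  then obtain s where s: "0 < s" "s < r"
    "u r - u 0 = (r - 0) * (fa (x + r *\<^sub>R b + s *\<^sub>R a) - fa (x + s *\<^sub>R a))"
    using MVT2[of 0 r u "\<lambda>s. fa (x + r *\<^sub>R b + s *\<^sub>R a) - fa (x + s *\<^sub>R a)"] \<open>r > 0\<close> by blast
  obtain t where t: "0 < t" "t < r"
    "fa (x + s *\<^sub>R a + r *\<^sub>R b) - fa (x + s *\<^sub>R a + 0 *\<^sub>R b) = (r - 0) * fab (x + s *\<^sub>R a + t *\<^sub>R b)"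
    using MVT2[of 0 r "\<lambda>t. fa (x + s *\<^sub>R a + t *\<^sub>R b)" "\<lambda>t. fab (x + s *\<^sub>R a + t *\<^sub>R b)"] \<open>r > 0\<close> fab by blast
  have "f (x + r *\<^sub>R a + r *\<^sub>R b) - f (x + r *\<^sub>R a) - f (x + r *\<^sub>R b) + f x = u r - u 0"
    by (simp add: u_def algebra_simps)
  also have "\<dots> = r * (r * fab (x + s *\<^sub>R a + t *\<^sub>R b))"
    using s(3) t(3) by (simp add: algebra_simps)
  finally show ?thesis using s t by (auto simp: power2_eq_square)
qed

lemma mixed_derivatives_commute:
  fixes f fa fab :: "'a::real_normed_vector \<Rightarrow> real"
  assumes fa: "\<And>x t. ((\<lambda>t. f (x + t *\<^sub>R a)) has_real_derivative fa (x + t *\<^sub>R a)) (at t)"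
    and fb: "\<And>x t. ((\<lambda>t. f (x + t *\<^sub>R b)) has_real_derivative fb (x + t *\<^sub>R b)) (at t)"
    and fab: "\<And>x t. ((\<lambda>t. fa (x + t *\<^sub>R b)) has_real_derivative fab (x + t *\<^sub>R b)) (at t)"
    and fba: "\<And>x t. ((\<lambda>t. fb (x + t *\<^sub>R a)) has_real_derivative fba (x + t *\<^sub>R a)) (at t)"
    and cont: "continuous_on UNIV fab" "continuous_on UNIV fba"
  shows "fab x = fba x"
proof -
  define r where "r n = 1 / real (Suc n)" for n
  have r: "r n > 0" for n by (simp add: r_def)
  have r0: "r \<longlonglongrightarrow> 0" unfolding r_def using LIMSEQ_inverse_real_of_nat by (simp add: divide_inverse)
  have "\<exists>s t s' t'. 0 < s \<and> s < r n \<and> 0 < t \<and> t < r n \<and> 0 < s' \<and> s' < r n \<and> 0 < t' \<and> t' < r n \<and>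
      fab (x + s *\<^sub>R a + t *\<^sub>R b) = fba (x + s' *\<^sub>R b + t' *\<^sub>R a)" for n
  proof -
    obtain s t where 1: "0 < s" "s < r n" "0 < t" "t < r n"
      "f (x + r n *\<^sub>R a + r n *\<^sub>R b) - f (x + r n *\<^sub>R a) - f (x + r n *\<^sub>R b) + f x = (r n)\<^sup>2 * fab (x + s *\<^sub>R a + t *\<^sub>R b)"
      using mixed_difference_mean_value[OF fa fab r] by blast
    obtain s' t' where 2: "0 < s'" "s' < r n" "0 < t'" "t' < r n"
      "f (x + r n *\<^sub>R b + r n *\<^sub>R a) - f (x + r n *\<^sub>R b) - f (x + r n *\<^sub>R a) + f x = (r n)\<^sup>2 * fba (x + s' *\<^sub>R b + t' *\<^sub>R a)"
      using mixed_difference_mean_value[OF fb fba r] by blast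
    have "x + r n *\<^sub>R b + r n *\<^sub>R a = x + r n *\<^sub>R a + r n *\<^sub>R b" by simp
    then have "(r n)\<^sup>2 * fab (x + s *\<^sub>R a + t *\<^sub>R b) = (r n)\<^sup>2 * fba (x + s' *\<^sub>R b + t' *\<^sub>R a)"
      using 1(5) 2(5) by (simp only: diff_right_commute)
    then show ?thesis using 1 2 r[of n] by auto
  qed
  then obtain s t s' t' where st: "\<And>n. 0 < s n" "\<And>n. s n < r n" "\<And>n. 0 < t n" "\<And>n. t n < r n"
      "\<And>n. 0 < s' n" "\<And>n. s' n < r n" "\<And>n. 0 < t' n" "\<And>n. t' n < r n"
    and eq: "\<And>n. fab (x + s n *\<^sub>R a + t n *\<^sub>R b) = fba (x + s' n *\<^sub>R b + t' n *\<^sub>R a)"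
    by metis
  have squeeze: "q \<longlonglongrightarrow> 0" if "\<And>n. 0 < q n" "\<And>n. q n < r n" for q
    by (rule real_tendsto_sandwich[OF _ _ tendsto_const r0])
      (use that in \<open>auto intro!: always_eventually less_imp_le\<close>)
  have lim: "s \<longlonglongrightarrow> 0" "t \<longlonglongrightarrow> 0" "s' \<longlonglongrightarrow> 0" "t' \<longlonglongrightarrow> 0"
    by (auto intro!: squeeze simp: st)
  have "(\<lambda>n. x + s n *\<^sub>R a + t n *\<^sub>R b) \<longlonglongrightarrow> x + 0 *\<^sub>R a + 0 *\<^sub>R b"
    by (intro tendsto_intros lim)
  then have 1: "(\<lambda>n. fab (x + s n *\<^sub>R a + t n *\<^sub>R b)) \<longlonglongrightarrow> fab x"
    using cont(1) by (intro isCont_tendsto_compose[of _ fab]) (auto simp: continuous_on_eq_continuous_at)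
  have "(\<lambda>n. x + s' n *\<^sub>R b + t' n *\<^sub>R a) \<longlonglongrightarrow> x + 0 *\<^sub>R b + 0 *\<^sub>R a"
    by (intro tendsto_intros lim)
  then have 2: "(\<lambda>n. fba (x + s' n *\<^sub>R b + t' n *\<^sub>R a)) \<longlonglongrightarrow> fba x"
    using cont(2) by (intro isCont_tendsto_compose[of _ fba]) (auto simp: continuous_on_eq_continuous_at)
  show ?thesis using LIMSEQ_unique[OF 1] 2 unfolding eq by blast
qed

lemma partial_commute:
  assumes "C_k (Suc (Suc k)) f"
  shows "partial i (partial j f) = partial j (partial i f)"
proof
  have cont: "continuous_on UNIV g" if "C_k m g" for m and g :: "real^'a \<Rightarrow> real"
    using that by (cases m) auto
  show "partial i (partial j f) x = partial j (partial i f) x" for x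
    by (rule mixed_derivatives_commute[where f = f and a = "axis j 1" and b = "axis i 1" and fa = "partial j f" and fb = "partial i f"])
      (use assms in \<open>auto intro!: partial_has_derivative intro: cont\<close>)
qed

lemma C_k_partial_has_derivative:
  assumes "C_k (Suc k) f"
  shows "((\<lambda>t. f (x + t *\<^sub>R axis i 1)) has_real_derivative partial i f (x + t *\<^sub>R axis i 1)) (at t)"
  using assms by (intro partial_has_derivative) auto

lemma partial_eqI:
  assumes "((\<lambda>t. f (x + t *\<^sub>R axis i 1)) has_real_derivative d) (at 0)"
  shows "partial i f x = d"
  unfolding partial_def using assms by (rule DERIV_imp_deriv)

lemma C_k_linear_combination:
  assumes "C_k k f" "C_k k g"
  shows "C_k k (\<lambda>x. a * f x + b * g x)"
  using assms
proof (induction k arbitrary: f g)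
  case 0
  then show ?case by (auto intro!: continuous_intros)
next
  case (Suc k)
  have d: "((\<lambda>t. a * f (x + t *\<^sub>R axis i 1) + b * g (x + t *\<^sub>R axis i 1)) has_real_derivative
      a * partial i f x + b * partial i g x) (at 0)" for i x
    using C_k_partial_has_derivative[OF Suc.prems(1), of x i 0] C_k_partial_has_derivative[OF Suc.prems(2), of x i 0]
    by (auto intro!: derivative_eq_intros)
  then have "partial i (\<lambda>x. a * f x + b * g x) = (\<lambda>x. a * partial i f x + b * partial i g x)" for i
    by (auto intro!: partial_eqI)
  moreover have "(\<lambda>t. a * f (x + t *\<^sub>R axis i 1) + b * g (x + t *\<^sub>R axis i 1)) field_differentiable at 0" for i x
    using d[of x i] unfolding field_differentiable_def by blast
  ultimately show ?case
    using Suc by (auto intro!: continuous_intros)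
qed

lemma partial_linear_combination:
  assumes "C_k (Suc k) f" "C_k (Suc k) g"
  shows "partial i (\<lambda>x. a * f x + b * g x) = (\<lambda>x. a * partial i f x + b * partial i g x)"
proof
  show "partial i (\<lambda>x. a * f x + b * g x) x = a * partial i f x + b * partial i g x" for x
    using C_k_partial_has_derivative[OF assms(1), of x i 0] C_k_partial_has_derivative[OF assms(2), of x i 0]
    by (auto intro!: derivative_eq_intros partial_eqI)
qed

text \<open>
  Derivatives are indexed by lists of coordinates instead of multi-indices: this keeps track of the
  order of differentiation and allows induction on the number of differentiations.
\<close>
definition iter_partial :: "'n::finite list \<Rightarrow> (real^'n \<Rightarrow> real) \<Rightarrow> real^'n \<Rightarrow> real" where
  "iter_partial L f = foldr partial L f"

lemma iter_partial_simps [simp]: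
  "iter_partial [] f = f"
  "iter_partial (i # L) f = partial i (iter_partial L f)"
  by (simp_all add: iter_partial_def)

lemma C_k_iter_partial:
  "C_k (length L + k) f \<Longrightarrow> C_k k (iter_partial L f)"
proof (induction L arbitrary: k)
  case (Cons i L)
  have "C_k (Suc k) (iter_partial L f)"
    using Cons.prems by (intro Cons.IH) (simp only: length_Cons add_Suc add_Suc_right)
  then show ?case by simp
qed simp


lemma C_k_mono: "C_k k f \<Longrightarrow> m \<le> k \<Longrightarrow> C_k m f"
proof (induction m arbitrary: k f)
  case 0
  then show ?case by (cases k) auto
next
  case (Suc m)
  then obtain k' where "k = Suc k'" by (cases k) auto
  then show ?case using Suc by auto
qed

lemma iter_partial_swap:
  assumes "C_k (length L + 2) f"
  shows "iter_partial (i # j # L) f = iter_partial (j # i # L) f"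
  using partial_commute[of 0 "iter_partial L f" i j] C_k_iter_partial[OF assms] by (simp add: numeral_2_eq_2)

lemma iter_partial_Cons_remove1:
  assumes "C_k k f" "length L \<le> k" "i \<in> set L"
  shows "iter_partial (i # remove1 i L) f = iter_partial L f"
  using assms(2,3)
proof (induction L)
  case (Cons j L)
  show ?case
  proof (cases "i = j")
    case False
    then have "i \<in> set L" using Cons.prems by simp
    then have len: "length (remove1 i L) + 2 = length (j # L)"
      using length_pos_if_in_set[OF \<open>i \<in> set L\<close>] by (simp add: length_remove1)
    have "C_k (length (j # L)) f"
      using C_k_mono[OF assms(1) Cons.prems(1)] .
    then have "iter_partial (i # j # remove1 i L) f = iter_partial (j # i # remove1 i L) f"
      by (intro iter_partial_swap) (simp only: len)
    then show ?thesis using False Cons \<open>i \<in> set L\<close> by simp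
  qed simp
qed simp

lemma iter_partial_mset_eq:
  assumes "C_k k f" "length L \<le> k" "mset L = mset L'"
  shows "iter_partial L f = iter_partial L' f"
  using assms(2,3)
proof (induction L arbitrary: L')
  case (Cons i L)
  then have "i \<in> set L'" by (metis list.set_intros(1) mset_eq_setD)
  have "mset L = mset (remove1 i L')" using Cons.prems by (simp flip: Cons.prems(2))
  then have "iter_partial L f = iter_partial (remove1 i L') f"
    using Cons by simp
  moreover have "length L' \<le> k" using Cons.prems by (metis mset_eq_length)
  ultimately show ?case
    using iter_partial_Cons_remove1[OF assms(1) _ \<open>i \<in> set L'\<close>] by simp
qed simp

definition index_list :: "('n::finite \<Rightarrow> nat) \<Rightarrow> 'n list" where
  "index_list \<alpha> = concat (map (\<lambda>i. replicate (\<alpha> i) i) coords)"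

lemma D_eq_iter_partial:
  fixes f :: "real^'n::finite \<Rightarrow> real"
  shows "D \<alpha> f = iter_partial (index_list \<alpha>) f"
proof -
  have "foldr (\<lambda>i g. (partial i ^^ \<alpha> i) g) xs f =
      foldr partial (concat (map (\<lambda>i. replicate (\<alpha> i) i) xs)) f" for xs
    by (induction xs) simp_all
  then show ?thesis by (simp add: D_def index_list_def iter_partial_def)
qed

lemma count_index_list: "count (mset (index_list \<alpha>)) i = \<alpha> i"
proof -
  have "count (mset (concat (map (\<lambda>i. replicate (\<alpha> i) i) xs))) i = (if i \<in> set xs then \<alpha> i else 0)"
    if "distinct xs" for xs
    using that by (induction xs) auto
  then show ?thesis
    by (simp add: index_list_def distinct_coords set_coords)
qed

lemma length_index_list: "length (index_list \<alpha>) = mi_order \<alpha>"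
proof -
  have "length (index_list \<alpha>) = (\<Sum>i\<leftarrow>coords. \<alpha> i)"
    by (simp add: index_list_def length_concat o_def)
  then show ?thesis
    by (simp add: mi_order_def sum_list_distinct_conv_sum_set distinct_coords set_coords)
qed

text \<open>
  Symmetry of mixed derivatives in the form used below: estimates for the derivatives \<open>D \<alpha>\<close>, which are
  taken in a chosen order of the coordinates, hold for all iterated derivatives.
\<close>
lemma iter_partial_eq_D:
  assumes "C_k k f" "length L \<le> k"
  shows "iter_partial L f = D (count (mset L)) f"
  unfolding D_eq_iter_partial using assms
  by (rule iter_partial_mset_eq) (simp add: multiset_eq_iff count_index_list)

lemma mi_order_count_mset: "mi_order (count (mset L)) = length L"
proof -
  have "mset (index_list (count (mset L))) = mset L"
    by (simp add: multiset_eq_iff count_index_list)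
  then show ?thesis by (metis length_index_list mset_eq_length)
qed

text \<open>
  One passes from \<open>y\<close> to \<open>x\<close> by changing one coordinate at a time and uses the mean value theorem along
  each axis.
\<close>
lemma lipschitz_of_bounded_partials:
  fixes f :: "real^'n::finite \<Rightarrow> real"
  assumes C1: "C_k (Suc 0) f" and M: "\<And>i x. \<bar>partial i f x\<bar> \<le> M"
  shows "\<bar>f x - f y\<bar> \<le> M * (real CARD('n) * norm (x - y))"
proof -
  have "M \<ge> 0" using M[of undefined undefined] by linarith
  have axis: "\<bar>f (x + t *\<^sub>R axis i 1) - f x\<bar> \<le> M * \<bar>t\<bar>" for x i t
    using field_differentiable_bound[of UNIV "\<lambda>t. f (x + t *\<^sub>R axis i 1)"
        "\<lambda>t. partial i f (x + t *\<^sub>R axis i 1)" M t 0] C_k_partial_has_derivative[OF C1] M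
    by simp
  \<comment> \<open>Induction on the set of coordinates in which \<open>x\<close> and \<open>y\<close> may differ.\<close>
  have "\<bar>f x - f y\<bar> \<le> M * (\<Sum>i\<in>S. \<bar>x $ i - y $ i\<bar>)" if "finite S" "\<And>i. i \<notin> S \<Longrightarrow> x $ i = y $ i" for S y
    using that
  proof (induction S arbitrary: y)
    case empty
    then have "x = y" by (simp add: vec_eq_iff)
    then show ?case by simp
  next
    case (insert i S)
    define z where "z = y + (x $ i - y $ i) *\<^sub>R axis i 1"
    have z: "z $ j = (if j = i then x $ i else y $ j)" for j
      by (simp add: z_def axis_def)
    have "\<bar>f x - f z\<bar> \<le> M * (\<Sum>i\<in>S. \<bar>x $ i - z $ i\<bar>)"
      using insert.prems by (intro insert.IH) (auto simp: z)
    also have "(\<Sum>i\<in>S. \<bar>x $ i - z $ i\<bar>) = (\<Sum>i\<in>S. \<bar>x $ i - y $ i\<bar>)"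
      using insert.hyps by (intro sum.cong) (auto simp: z)
    finally show ?case
      using axis[of y "x $ i - y $ i" i] insert.hyps by (simp add: z_def algebra_simps)
  qed
  from this[of UNIV y] have "\<bar>f x - f y\<bar> \<le> M * (\<Sum>i\<in>UNIV. \<bar>(x - y) $ i\<bar>)" by simp
  also have "\<dots> \<le> M * (\<Sum>i\<in>(UNIV::'n set). norm (x - y))"
    using \<open>M \<ge> 0\<close> by (intro mult_left_mono sum_mono component_le_norm_cart)
  finally show ?thesis by simp
qed

lemma iter_partial_linear_combination:
  assumes "C_k k f" "C_k k g" "length L \<le> k"
  shows "iter_partial L (\<lambda>x. a * f x + b * g x) = (\<lambda>x. a * iter_partial L f x + b * iter_partial L g x)"
  using assms(3)
proof (induction L)
  case (Cons i L)
  have "C_k (length L + Suc 0) f" "C_k (length L + Suc 0) g"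
    using Cons.prems by (auto intro!: C_k_mono[OF assms(1)] C_k_mono[OF assms(2)] simp del: C_k.simps)
  then have "C_k (Suc 0) (iter_partial L f)" "C_k (Suc 0) (iter_partial L g)"
    by (blast intro: C_k_iter_partial)+
  then show ?case
    using Cons by (simp add: partial_linear_combination del: C_k.simps)
qed simp


section \<open>Subspaces and operators in normed spaces of functions\<close>

lemma closed_subspaceD:
  assumes "closed_subspace V N S"
  shows "S \<subseteq> V" "(\<lambda>_. 0) \<in> S" "f \<in> S \<Longrightarrow> g \<in> S \<Longrightarrow> (\<lambda>a. f a + g a) \<in> S" "f \<in> S \<Longrightarrow> (\<lambda>a. c * f a) \<in> S"
    "f \<in> V \<Longrightarrow> (\<And>m::nat. s m \<in> S) \<Longrightarrow> (\<lambda>m. N (\<lambda>a. s m a - f a)) \<longlonglongrightarrow> 0 \<Longrightarrow> f \<in> S"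
  using assms unfolding closed_subspace_def by blast+

lemma closed_subspace_hull:
  assumes V: "closed_subspace V N V" "S \<subseteq> V"
  shows "closed_subspace V N (closed_subspace V N hull S)"
proof -
  let ?F = "{T. closed_subspace V N T \<and> S \<subseteq> T}"
  have F: "closed_subspace V N T" if "T \<in> ?F" for T using that by blast
  have sub: "\<Inter>?F \<subseteq> V" using V by blast
  have "closed_subspace V N (\<Inter>?F)"
    unfolding closed_subspace_def[of V N "\<Inter>?F"]
  proof (intro conjI ballI allI impI InterI sub)
    fix f g T assume "f \<in> \<Inter>?F" "g \<in> \<Inter>?F" and T: "T \<in> ?F"
    then have "f \<in> T" "g \<in> T" by blast+
    then show "(\<lambda>a. f a + g a) \<in> T" by (rule closed_subspaceD(3)[OF F[OF T]])
  next
    fix c f T assume "f \<in> \<Inter>?F" and T: "T \<in> ?F"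
    then have "f \<in> T" by blast
    then show "(\<lambda>a. c * f a) \<in> T" by (rule closed_subspaceD(4)[OF F[OF T]])
  next
    fix s f T assume f: "f \<in> V" and s: "(\<forall>m::nat. s m \<in> \<Inter>?F) \<and> (\<lambda>m. N (\<lambda>a. s m a - f a)) \<longlonglongrightarrow> 0"
      and T: "T \<in> ?F"
    have "s m \<in> T" for m using s T by blast
    then show "f \<in> T" using closed_subspaceD(5)[OF F[OF T] f, of s] s by blast
  qed (rule closed_subspaceD(2)[OF F])
  then show ?thesis by (simp add: hull_def)
qed

lemma closed_subspace_linear_combination:
  assumes S: "closed_subspace V N S" and "f \<in> S" "g \<in> S"
  shows "(\<lambda>x. a * f x + b * g x) \<in> S"
  by (rule closed_subspaceD(3)[OF S closed_subspaceD(4)[OF S] closed_subspaceD(4)[OF S]]; fact)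

lemma bounded_linear_onD:
  assumes "bounded_linear_on V N T"
  shows "f \<in> V \<Longrightarrow> g \<in> V \<Longrightarrow> T (\<lambda>a. f a + g a) = T f + T g" "f \<in> V \<Longrightarrow> T (\<lambda>a. c * f a) = c *\<^sub>R T f"
    "\<exists>K. \<forall>f\<in>V. norm (T f) \<le> K * N f"
  using assms unfolding bounded_linear_on_def by blast+

lemma bounded_linear_on_linear_combination:
  assumes S: "closed_subspace V N S" and T: "bounded_linear_on S N T" and "f \<in> S" "g \<in> S"
  shows "T (\<lambda>x. a * f x + b * g x) = a *\<^sub>R T f + b *\<^sub>R T g"
  using bounded_linear_onD(1)[OF T closed_subspaceD(4)[OF S \<open>f \<in> S\<close>] closed_subspaceD(4)[OF S \<open>g \<in> S\<close>]]
    bounded_linear_onD(2)[OF T \<open>f \<in> S\<close>] bounded_linear_onD(2)[OF T \<open>g \<in> S\<close>]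
  by simp

lemma dual_space_closed_subspace: "closed_subspace (dual_space V N) N' (dual_space V N)"
proof -
  have "(\<lambda>_. 0) \<in> dual_space V N"
    by (auto simp: dual_space_def bounded_linear_on_def intro: exI[of _ 0])
  moreover have "(\<lambda>a. \<phi> a + \<psi> a) \<in> dual_space V N" if "\<phi> \<in> dual_space V N" "\<psi> \<in> dual_space V N" for \<phi> \<psi>
  proof -
    have \<phi>: "bounded_linear_on V N \<phi>" and \<psi>: "bounded_linear_on V N \<psi>"
      and off: "\<forall>f. f \<notin> V \<longrightarrow> \<phi> f + \<psi> f = 0"
      using that by (auto simp: dual_space_def)
    obtain K K' where K: "\<forall>f\<in>V. norm (\<phi> f) \<le> K * N f" "\<forall>f\<in>V. norm (\<psi> f) \<le> K' * N f"
      using bounded_linear_onD(3)[OF \<phi>] bounded_linear_onD(3)[OF \<psi>] by blast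
    have "norm (\<phi> f + \<psi> f) \<le> (K + K') * N f" if "f \<in> V" for f
      using norm_triangle_ineq[of "\<phi> f" "\<psi> f"] K that by (fastforce simp: distrib_right)
    then have "\<exists>K. \<forall>f\<in>V. norm (\<phi> f + \<psi> f) \<le> K * N f" by blast
    then have "bounded_linear_on V N (\<lambda>a. \<phi> a + \<psi> a)"
      unfolding bounded_linear_on_def[of V N "\<lambda>a. \<phi> a + \<psi> a"]
      by (simp add: bounded_linear_onD[OF \<phi>] bounded_linear_onD[OF \<psi>] algebra_simps)
    then show ?thesis using off by (simp add: dual_space_def)
  qed
  moreover have "(\<lambda>a. c * \<phi> a) \<in> dual_space V N" if "\<phi> \<in> dual_space V N" for \<phi> c
  proof -
    have \<phi>: "bounded_linear_on V N \<phi>" and off: "\<forall>f. f \<notin> V \<longrightarrow> c * \<phi> f = 0"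
      using that by (auto simp: dual_space_def)
    obtain K where K: "\<forall>f\<in>V. norm (\<phi> f) \<le> K * N f"
      using bounded_linear_onD(3)[OF \<phi>] by blast
    then have "\<forall>f\<in>V. norm (c * \<phi> f) \<le> (\<bar>c\<bar> * K) * N f"
      by (auto simp: abs_mult mult.assoc intro!: mult_left_mono)
    then have "\<exists>K. \<forall>f\<in>V. norm (c * \<phi> f) \<le> K * N f" by blast
    then have "bounded_linear_on V N (\<lambda>a. c * \<phi> a)"
      unfolding bounded_linear_on_def[of V N "\<lambda>a. c * \<phi> a"]
      by (simp add: bounded_linear_onD[OF \<phi>] algebra_simps)
    then show ?thesis using off by (simp add: dual_space_def)
  qed
  ultimately show ?thesis unfolding closed_subspace_def by blast
qed

lemma op_norm_le:
  assumes "\<And>f. f \<in> V \<Longrightarrow> N f \<le> 1 \<Longrightarrow> norm (T f) \<le> M" and "f\<^sub>0 \<in> V" "N f\<^sub>0 \<le> 1"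
  shows "op_norm V N T \<le> M"
  unfolding op_norm_def using assms by (intro cSUP_least) auto

lemma norm_le_op_norm_unit_ball:
  assumes T: "bounded_linear_on V N T" and N: "\<And>f. f \<in> V \<Longrightarrow> 0 \<le> N f" and f: "f \<in> V" "N f \<le> 1"
  shows "norm (T f) \<le> op_norm V N T"
proof -
  obtain K where K: "\<And>f. f \<in> V \<Longrightarrow> norm (T f) \<le> K * N f"
    using bounded_linear_onD(3)[OF T] by blast
  have "norm (T f) \<le> \<bar>K\<bar>" if "f \<in> V" "N f \<le> 1" for f
  proof -
    have "norm (T f) \<le> \<bar>K\<bar> * N f"
      using K[OF that(1)] N[OF that(1)] by (meson abs_ge_self mult_right_mono order_trans)
    also have "\<dots> \<le> \<bar>K\<bar> * 1" using that by (intro mult_left_mono) auto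
    finally show ?thesis by simp
  qed
  then have "bdd_above ((\<lambda>f. norm (T f)) ` {f \<in> V. N f \<le> 1})"
    by (intro bdd_aboveI2[of _ _ "\<bar>K\<bar>"]) auto
  then show ?thesis unfolding op_norm_def using f by (intro cSUP_upper) auto
qed

text \<open>
  The supremum over the unit ball is applied to \<open>f / N f\<close>, which \<open>hom\<close> places in the unit ball. If
  \<open>N f = 0\<close>, boundedness already forces \<open>T f = 0\<close>.
\<close>
lemma norm_le_op_norm:
  assumes T: "bounded_linear_on V N T" and N: "\<And>f. f \<in> V \<Longrightarrow> 0 \<le> N f"
    and V: "\<And>c. (\<lambda>a. c * f a) \<in> V" and hom: "\<And>c. N (\<lambda>a. c * f a) \<le> \<bar>c\<bar> * N f"
    and f: "f \<in> V"
  shows "norm (T f) \<le> op_norm V N T * N f"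
proof (cases "N f = 0")
  case True
  then show ?thesis using bounded_linear_onD(3)[OF T] f by fastforce
next
  case False
  then have pos: "N f > 0" using N[OF f] by simp
  have "T (\<lambda>a. (1 / N f) * f a) = (1 / N f) *\<^sub>R T f"
    by (rule bounded_linear_onD(2)[OF T f])
  moreover have "norm (T (\<lambda>a. (1 / N f) * f a)) \<le> op_norm V N T"
    using hom[of "1 / N f"] pos by (intro norm_le_op_norm_unit_ball[OF T N V]) auto
  ultimately show ?thesis using pos by (simp add: field_simps)
qed


section \<open>Evaluations of derivatives as elements of the predual\<close>

text \<open>
  The real-valued form of \<open>Cbw_enorm k \<omega> f \<le> M\<close> for functions of class \<open>C\<^sup>k\<close>, with all orders of
  differentiation; \<open>CbwI\<close> and \<open>Cbw_bound_norm\<close> establish the connection.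
\<close>
definition Cbw_bound :: "nat \<Rightarrow> (real \<Rightarrow> real) \<Rightarrow> real \<Rightarrow> (real^'n::finite \<Rightarrow> real) \<Rightarrow> bool" where
  "Cbw_bound k \<omega> M f \<longleftrightarrow>
     (\<forall>L x. length L \<le> k \<longrightarrow> \<bar>iter_partial L f x\<bar> \<le> M) \<and>
     (\<forall>L x y. length L = k \<longrightarrow> x \<noteq> y \<longrightarrow> \<bar>iter_partial L f x - iter_partial L f y\<bar> \<le> M * \<omega> (norm (x - y)))"

lemma Cbw_boundD:
  assumes "Cbw_bound k \<omega> M f"
  shows "length L \<le> k \<Longrightarrow> \<bar>iter_partial L f x\<bar> \<le> M"
    and "length L = k \<Longrightarrow> x \<noteq> y \<Longrightarrow> \<bar>iter_partial L f x - iter_partial L f y\<bar> \<le> M * \<omega> (norm (x - y))"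
  using assms by (auto simp: Cbw_bound_def)

lemma Cbw_bound_nonneg: "Cbw_bound k \<omega> M f \<Longrightarrow> 0 \<le> M"
  using Cbw_boundD(1)[of k \<omega> M f "[]" undefined] by simp

text \<open>
  The functionals \<open>\<delta>\<^sub>x\<^sup>\<alpha>\<close>, extended to arbitrary orders of differentiation so that one more
  differentiation is one more list element.
\<close>
definition iter_delta ::
  "nat \<Rightarrow> (real \<Rightarrow> real) \<Rightarrow> 'n::finite list \<Rightarrow> real^'n \<Rightarrow> (real^'n \<Rightarrow> real) \<Rightarrow> real" where
  "iter_delta k \<omega> L x f = (if f \<in> Cbw k \<omega> then iter_partial L f x else 0)"

lemma delta_eq_iter_delta: "delta k \<omega> \<alpha> x = iter_delta k \<omega> (index_list \<alpha>) x"
  by (simp add: fun_eq_iff delta_def iter_delta_def D_eq_iter_partial)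

lemma delta_0_eq_iter_delta:
  fixes x :: "real^'n::finite"
  shows "delta k \<omega> (\<lambda>_. 0) x = iter_delta k \<omega> [] x"
proof -
  have "index_list (\<lambda>_::'n. 0) = []"
    using length_index_list[of "\<lambda>_::'n. 0"] by (simp add: mi_order_def)
  then show ?thesis by (simp add: delta_eq_iter_delta)
qed

context
  fixes k :: nat and \<omega> :: "real \<Rightarrow> real"
  assumes mod: "modulus_of_continuity \<omega>"
begin

lemma modulus_pos: "x \<noteq> y \<Longrightarrow> 0 < \<omega> (norm (x - y))"
  using mod by (simp add: modulus_of_continuity_def)

lemma CbwI:
  fixes f :: "real^'n::finite \<Rightarrow> real"
  assumes "C_k k f" and M: "Cbw_bound k \<omega> M f"
  shows "f \<in> Cbw k \<omega>" "Cbw_norm k \<omega> f \<le> M"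
proof -
  note D = M[THEN Cbw_boundD(1)] M[THEN Cbw_boundD(2)]
  have "Cb_enorm k f \<le> ennreal M"
    unfolding Cb_enorm_def
    by (intro SUP_least) (auto intro!: ennreal_leI D(1) simp: D_eq_iter_partial length_index_list)
  moreover have "Cbw_eseminorm k \<omega> f \<le> ennreal M"
    unfolding Cbw_eseminorm_def
    by (intro SUP_least)
      (auto intro!: ennreal_leI D(2) simp: D_eq_iter_partial length_index_list pos_divide_le_eq modulus_pos)
  ultimately have le: "Cbw_enorm k \<omega> f \<le> ennreal M" by (simp add: Cbw_enorm_def)
  then show "f \<in> Cbw k \<omega>"
    using assms(1) by (auto simp: Cbw_def intro: le_less_trans)
  show "Cbw_norm k \<omega> f \<le> M"
    unfolding Cbw_norm_def using le Cbw_bound_nonneg[OF M] by (rule enn2real_leI[rotated])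
qed

lemma Cbw_bound_norm:
  fixes f :: "real^'n::finite \<Rightarrow> real"
  assumes "f \<in> Cbw k \<omega>"
  shows "Cbw_bound k \<omega> (Cbw_norm k \<omega> f) f"
proof -
  have "C_k k f" and fin: "Cbw_enorm k \<omega> f < \<infinity>" using assms by (auto simp: Cbw_def)
  have N: "r \<le> Cbw_norm k \<omega> f" if "ennreal r \<le> Cbw_enorm k \<omega> f" "r \<ge> 0" for r
    unfolding Cbw_norm_def using enn2real_mono[OF that(1)] fin that(2) by simp
  have "\<bar>iter_partial L f x\<bar> \<le> Cbw_norm k \<omega> f" if "length L \<le> k" for L x
  proof (rule N)
    have "ennreal \<bar>iter_partial L f x\<bar> \<le> Cb_enorm k f"
      unfolding Cb_enorm_def using that
      by (intro SUP_upper2[of "count (mset L)"] SUP_upper2[of x])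
        (auto simp: iter_partial_eq_D[OF \<open>C_k k f\<close>] mi_order_count_mset)
    then show "ennreal \<bar>iter_partial L f x\<bar> \<le> Cbw_enorm k \<omega> f" by (simp add: Cbw_enorm_def le_max_iff_disj)
  qed simp
  moreover have "\<bar>iter_partial L f x - iter_partial L f y\<bar> / \<omega> (norm (x - y)) \<le> Cbw_norm k \<omega> f"
    if "length L = k" "x \<noteq> y" for L x y
  proof (rule N)
    have "ennreal (\<bar>iter_partial L f x - iter_partial L f y\<bar> / \<omega> (norm (x - y))) \<le> Cbw_eseminorm k \<omega> f"
      unfolding Cbw_eseminorm_def using that
      by (intro SUP_upper2[of "count (mset L)"] SUP_upper2[of "(x, y)"])
        (auto simp: iter_partial_eq_D[OF \<open>C_k k f\<close>] mi_order_count_mset)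
    then show "ennreal (\<bar>iter_partial L f x - iter_partial L f y\<bar> / \<omega> (norm (x - y))) \<le> Cbw_enorm k \<omega> f"
      by (simp add: Cbw_enorm_def le_max_iff_disj)
    show "0 \<le> \<bar>iter_partial L f x - iter_partial L f y\<bar> / \<omega> (norm (x - y))"
      using modulus_pos[OF that(2)] by simp
  qed
  ultimately show ?thesis
    by (simp add: Cbw_bound_def pos_divide_le_eq modulus_pos)
qed

lemma Cbw_C_k: "f \<in> Cbw k \<omega> \<Longrightarrow> C_k k f"
  by (simp add: Cbw_def)

lemma Cbw_norm_nonneg: "0 \<le> Cbw_norm k \<omega> f"
  by (simp add: Cbw_norm_def)

lemma Cbw_linear_combination:
  fixes f g :: "real^'n::finite \<Rightarrow> real"
  assumes f: "f \<in> Cbw k \<omega>" and g: "g \<in> Cbw k \<omega>"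
  shows "(\<lambda>x. a * f x + b * g x) \<in> Cbw k \<omega>"
    and "Cbw_norm k \<omega> (\<lambda>x. a * f x + b * g x) \<le> \<bar>a\<bar> * Cbw_norm k \<omega> f + \<bar>b\<bar> * Cbw_norm k \<omega> g"
proof -
  note fb = Cbw_boundD[OF Cbw_bound_norm[OF f]] and gb = Cbw_boundD[OF Cbw_bound_norm[OF g]]
  have le: "\<bar>a * r + b * s\<bar> \<le> \<bar>a\<bar> * R + \<bar>b\<bar> * S" if "\<bar>r\<bar> \<le> R" "\<bar>s\<bar> \<le> S" for r s R S :: real
  proof -
    have "\<bar>a * r + b * s\<bar> \<le> \<bar>a\<bar> * \<bar>r\<bar> + \<bar>b\<bar> * \<bar>s\<bar>"
      using abs_triangle_ineq[of "a * r" "b * s"] by (simp add: abs_mult)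
    also have "\<dots> \<le> \<bar>a\<bar> * R + \<bar>b\<bar> * S" using that by (intro add_mono mult_left_mono) auto
    finally show ?thesis .
  qed
  have "Cbw_bound k \<omega> (\<bar>a\<bar> * Cbw_norm k \<omega> f + \<bar>b\<bar> * Cbw_norm k \<omega> g) (\<lambda>x. a * f x + b * g x)"
    unfolding Cbw_bound_def
  proof (intro conjI allI impI)
    fix L :: "'n list" and x y :: "real^'n" assume "length L = k" "x \<noteq> y"
    then have "\<bar>a * (iter_partial L f x - iter_partial L f y) + b * (iter_partial L g x - iter_partial L g y)\<bar>
        \<le> \<bar>a\<bar> * (Cbw_norm k \<omega> f * \<omega> (norm (x - y))) + \<bar>b\<bar> * (Cbw_norm k \<omega> g * \<omega> (norm (x - y)))"
      by (intro le fb gb)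
    then show "\<bar>iter_partial L (\<lambda>x. a * f x + b * g x) x - iter_partial L (\<lambda>x. a * f x + b * g x) y\<bar>
        \<le> (\<bar>a\<bar> * Cbw_norm k \<omega> f + \<bar>b\<bar> * Cbw_norm k \<omega> g) * \<omega> (norm (x - y))"
      using \<open>length L = k\<close>
      by (simp add: iter_partial_linear_combination[OF Cbw_C_k[OF f] Cbw_C_k[OF g]] algebra_simps)
  qed (simp add: iter_partial_linear_combination[OF Cbw_C_k[OF f] Cbw_C_k[OF g]] le fb gb)
  note CbwI[OF C_k_linear_combination[OF Cbw_C_k[OF f] Cbw_C_k[OF g]] this]
  then show "(\<lambda>x. a * f x + b * g x) \<in> Cbw k \<omega>"
    "Cbw_norm k \<omega> (\<lambda>x. a * f x + b * g x) \<le> \<bar>a\<bar> * Cbw_norm k \<omega> f + \<bar>b\<bar> * Cbw_norm k \<omega> g"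
    by auto
qed

lemma zero_in_Cbw:
  "(\<lambda>_. 0) \<in> (Cbw k \<omega> :: (real^'n::finite \<Rightarrow> real) set)" "Cbw_norm k \<omega> (\<lambda>_::real^'n. 0) \<le> 1"
proof -
  have "partial i (\<lambda>_::real^'n. 0) = (\<lambda>_. 0)" for i
    by (simp add: partial_def fun_eq_iff)
  then have C: "C_k m (\<lambda>_::real^'n. 0)" for m
    by (induction m) auto
  have "iter_partial L (\<lambda>_::real^'n. 0) = (\<lambda>_. 0)" for L
    by (induction L) (auto simp: partial_def)
  then have "Cbw_bound k \<omega> 0 (\<lambda>_::real^'n. 0)" by (simp add: Cbw_bound_def)
  from CbwI[OF C this] show "(\<lambda>_::real^'n. 0) \<in> Cbw k \<omega>" "Cbw_norm k \<omega> (\<lambda>_::real^'n. 0) \<le> 1" by auto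
qed

lemma dual_norm_le:
  fixes \<phi> :: "(real^'n::finite \<Rightarrow> real) \<Rightarrow> real"
  assumes "\<And>f. f \<in> Cbw k \<omega> \<Longrightarrow> Cbw_norm k \<omega> f \<le> 1 \<Longrightarrow> \<bar>\<phi> f\<bar> \<le> M"
  shows "Cbw_dual_norm k \<omega> \<phi> \<le> M"
  using assms zero_in_Cbw by (intro op_norm_le[of _ _ _ _ "\<lambda>_. 0"]) auto

lemma le_dual_norm:
  assumes "\<phi> \<in> Cbw_dual k \<omega>" "f \<in> Cbw k \<omega>" "Cbw_norm k \<omega> f \<le> 1"
  shows "\<bar>\<phi> f\<bar> \<le> Cbw_dual_norm k \<omega> \<phi>"
proof -
  have "bounded_linear_on (Cbw k \<omega>) (Cbw_norm k \<omega>) \<phi>"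
    using assms(1) by (simp add: dual_space_def)
  then have "norm (\<phi> f) \<le> Cbw_dual_norm k \<omega> \<phi>"
    using assms(2,3) by (intro norm_le_op_norm_unit_ball) (simp_all add: Cbw_norm_nonneg)
  then show ?thesis by simp
qed

lemma dual_norm_nonneg: "\<phi> \<in> Cbw_dual k \<omega> \<Longrightarrow> 0 \<le> Cbw_dual_norm k \<omega> \<phi>"
  using le_dual_norm[OF _ zero_in_Cbw] by (meson abs_ge_zero order_trans)

lemma dual_norm_scale_le:
  assumes "\<phi> \<in> Cbw_dual k \<omega>"
  shows "Cbw_dual_norm k \<omega> (\<lambda>f. c * \<phi> f) \<le> \<bar>c\<bar> * Cbw_dual_norm k \<omega> \<phi>"
  using le_dual_norm[OF assms] by (intro dual_norm_le) (auto simp: abs_mult intro: mult_left_mono)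

lemma iter_delta_in_dual:
  fixes x :: "real^'n::finite"
  assumes "length L \<le> k"
  shows "iter_delta k \<omega> L x \<in> Cbw_dual k \<omega>"
proof -
  have lin: "iter_delta k \<omega> L x (\<lambda>y. a * f y + b * g y) = a * iter_delta k \<omega> L x f + b * iter_delta k \<omega> L x g"
    if "f \<in> Cbw k \<omega>" "g \<in> Cbw k \<omega>" for a b f g
    using that Cbw_linear_combination(1)[OF that]
      iter_partial_linear_combination[OF Cbw_C_k[OF that(1)] Cbw_C_k[OF that(2)] assms]
    by (simp add: iter_delta_def)
  have "\<bar>iter_delta k \<omega> L x f\<bar> \<le> 1 * Cbw_norm k \<omega> f" if "f \<in> Cbw k \<omega>" for f
    using Cbw_boundD(1)[OF Cbw_bound_norm[OF that] assms] that by (simp add: iter_delta_def)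
  then show ?thesis
    using lin[where a = 1 and b = 1] lin[where b = 0]
    by (auto simp: dual_space_def bounded_linear_on_def iter_delta_def[of _ _ _ _ f for f]
        intro!: exI[of _ 1])
qed

lemma Gbw_closed_subspace:
  "closed_subspace (Cbw_dual k \<omega>) (Cbw_dual_norm k \<omega>) (Gbw k \<omega> :: ((real^'n::finite \<Rightarrow> real) \<Rightarrow> real) set)"
  unfolding Gbw_def
  by (rule closed_subspace_hull[OF dual_space_closed_subspace])
    (auto simp: delta_0_eq_iter_delta intro: iter_delta_in_dual)

lemma Gbw_subset_dual: "Gbw k \<omega> \<subseteq> Cbw_dual k \<omega>"
  by (rule closed_subspaceD(1)[OF Gbw_closed_subspace])

text \<open>
  A modulus of continuity shared by the derivatives of all orders up to \<open>k\<close> of all functions in the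
  unit ball: \<open>\<omega>\<close> controls order \<open>k\<close>, and a bound by one on the first partial derivatives gives the
  Lipschitz constant \<open>CARD('n)\<close> for the lower orders.
\<close>
definition delta_modulus :: "'n::finite itself \<Rightarrow> real \<Rightarrow> real" where
  "delta_modulus _ t = \<omega> t + real CARD('n) * t"

lemma delta_modulus_nonneg: "0 < t \<Longrightarrow> 0 \<le> delta_modulus TYPE('n::finite) t"
  using mod by (simp add: modulus_of_continuity_def delta_modulus_def less_imp_le)

lemma delta_modulus_mono:
  assumes "0 < s" "s \<le> t"
  shows "delta_modulus TYPE('n::finite) s \<le> delta_modulus TYPE('n) t"
proof -
  have "\<omega> s \<le> \<omega> t"
    using mod assms by (auto simp: modulus_of_continuity_def mono_on_def)
  then show ?thesis using assms by (auto simp: delta_modulus_def intro!: add_mono mult_left_mono)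
qed

lemma delta_modulus_norm_tendsto_0:
  "((\<lambda>y. delta_modulus TYPE('n::finite) (norm (y - x))) \<longlongrightarrow> 0) (at (x :: 'a::real_normed_vector))"
proof -
  have "filterlim (\<lambda>y. norm (y - x)) (at_right 0) (at x)"
    unfolding filterlim_at
  proof
    show "\<forall>\<^sub>F y in at x. norm (y - x) \<in> {0<..} \<and> norm (y - x) \<noteq> 0"
      by (simp add: eventually_at_filter)
    have "((\<lambda>y. norm (y - x)) \<longlongrightarrow> norm (x - x)) (at x)"
      by (intro tendsto_intros)
    then show "((\<lambda>y. norm (y - x)) \<longlongrightarrow> 0) (at x)" by simp
  qed
  moreover have "(delta_modulus TYPE('n) \<longlongrightarrow> 0) (at_right 0)"
  proof -
    have "((\<lambda>t. \<omega> t + real CARD('n) * t) \<longlongrightarrow> 0 + real CARD('n) * 0) (at_right 0)"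
      using mod by (intro tendsto_intros) (simp add: modulus_of_continuity_def)
    then show ?thesis by (simp add: delta_modulus_def[abs_def])
  qed
  ultimately show ?thesis by (rule filterlim_compose[rotated])
qed

lemma iter_partial_modulus:
  fixes f :: "real^'n::finite \<Rightarrow> real"
  assumes f: "f \<in> Cbw k \<omega>" "Cbw_norm k \<omega> f \<le> 1" and L: "length L \<le> k" and "x \<noteq> y"
  shows "\<bar>iter_partial L f x - iter_partial L f y\<bar> \<le> delta_modulus TYPE('n) (norm (x - y))"
proof (cases "length L = k")
  case True
  have "\<omega> (norm (x - y)) > 0" using \<open>x \<noteq> y\<close> by (rule modulus_pos)
  then have "Cbw_norm k \<omega> f * \<omega> (norm (x - y)) \<le> 1 * \<omega> (norm (x - y))"
    using f(2) by (intro mult_right_mono) auto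
  then have "\<bar>iter_partial L f x - iter_partial L f y\<bar> \<le> \<omega> (norm (x - y))"
    using Cbw_boundD(2)[OF Cbw_bound_norm[OF f(1)] True \<open>x \<noteq> y\<close>] by linarith
  then show ?thesis by (simp add: delta_modulus_def add_increasing2)
next
  case False
  then have len: "length L + Suc 0 \<le> k" using L by simp
  have "\<bar>iter_partial L f x - iter_partial L f y\<bar> \<le> 1 * (real CARD('n) * norm (x - y))"
  proof (rule lipschitz_of_bounded_partials)
    show "C_k (Suc 0) (iter_partial L f)"
      by (rule C_k_iter_partial[OF C_k_mono[OF Cbw_C_k[OF f(1)] len]])
    show "\<bar>partial i (iter_partial L f) z\<bar> \<le> 1" for i z
      using Cbw_boundD(1)[OF Cbw_bound_norm[OF f(1)], of "i # L" z] f(2) len by simp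
  qed
  moreover have "\<omega> (norm (x - y)) > 0" using \<open>x \<noteq> y\<close> by (rule modulus_pos)
  ultimately show ?thesis by (simp add: delta_modulus_def)
qed

lemma dual_norm_iter_delta_le:
  fixes x :: "real^'n::finite"
  shows "length L \<le> k \<Longrightarrow> Cbw_dual_norm k \<omega> (iter_delta k \<omega> L x) \<le> 1"
proof (rule dual_norm_le)
  fix f :: "real^'n \<Rightarrow> real" assume "length L \<le> k" and f: "f \<in> Cbw k \<omega>" "Cbw_norm k \<omega> f \<le> 1"
  then have "\<bar>iter_partial L f x\<bar> \<le> Cbw_norm k \<omega> f"
    by (intro Cbw_boundD(1)[OF Cbw_bound_norm])
  then show "\<bar>iter_delta k \<omega> L x f\<bar> \<le> 1" using f by (simp add: iter_delta_def)
qed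

text \<open>
  The difference is written as a linear combination with coefficients \<open>1\<close> and \<open>-1\<close>, the form in which
  subspaces and bounded operators treat it below.
\<close>
lemma dual_norm_iter_delta_diff_le:
  fixes x y :: "real^'n::finite"
  assumes "length L \<le> k" "x \<noteq> y"
  shows "Cbw_dual_norm k \<omega> (\<lambda>f. 1 * iter_delta k \<omega> L x f + (-1) * iter_delta k \<omega> L y f)
    \<le> delta_modulus TYPE('n) (norm (x - y))"
  using iter_partial_modulus[OF _ _ assms] by (intro dual_norm_le) (simp add: iter_delta_def)

lemma dual_norm_iter_delta_diff_top_order_le:
  fixes x y :: "real^'n::finite"
  assumes "length L = k" "x \<noteq> y"
  shows "Cbw_dual_norm k \<omega> (\<lambda>f. 1 * iter_delta k \<omega> L x f + (-1) * iter_delta k \<omega> L y f) \<le> \<omega> (norm (x - y))"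
proof (rule dual_norm_le)
  fix f :: "real^'n \<Rightarrow> real" assume f: "f \<in> Cbw k \<omega>" "Cbw_norm k \<omega> f \<le> 1"
  have "\<omega> (norm (x - y)) > 0" using \<open>x \<noteq> y\<close> by (rule modulus_pos)
  then have "Cbw_norm k \<omega> f * \<omega> (norm (x - y)) \<le> 1 * \<omega> (norm (x - y))"
    using f(2) by (intro mult_right_mono) auto
  then show "\<bar>1 * iter_delta k \<omega> L x f + (-1) * iter_delta k \<omega> L y f\<bar> \<le> \<omega> (norm (x - y))"
    using Cbw_boundD(2)[OF Cbw_bound_norm[OF f(1)] assms] f(1) by (simp add: iter_delta_def)
qed

definition delta_quotient :: "'n::finite list \<Rightarrow> 'n \<Rightarrow> real^'n \<Rightarrow> real \<Rightarrow> (real^'n \<Rightarrow> real) \<Rightarrow> real" where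
  "delta_quotient L i x t f =
     (1 / t) * iter_delta k \<omega> L (x + t *\<^sub>R axis i 1) f + (- 1 / t) * iter_delta k \<omega> L x f"

text \<open>
  The derivative of \<open>x \<mapsto> \<delta>\<^sub>x\<^sup>\<alpha>\<close> along a coordinate, with a rate that is uniform over the
  unit ball: by the mean value theorem, a difference quotient of \<open>g = iter_partial L f\<close> differs from its
  derivative at \<open>x\<close> by at most the oscillation of \<open>partial i g\<close> over the points
  \<open>x + s *\<^sub>R axis i 1\<close> with \<open>\<bar>s\<bar> \<le> \<bar>t\<bar>\<close>, and that is
  controlled by the common modulus.
\<close>
lemma dual_norm_delta_quotient_le:
  fixes x :: "real^'n::finite"
  assumes "length L < k" "t \<noteq> 0"
  shows "Cbw_dual_norm k \<omega> (\<lambda>f. 1 * delta_quotient L i x t f + (-1) * iter_delta k \<omega> (i # L) x f)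
    \<le> delta_modulus TYPE('n) \<bar>t\<bar>"
proof (rule dual_norm_le)
  fix f :: "real^'n \<Rightarrow> real" assume f: "f \<in> Cbw k \<omega>" "Cbw_norm k \<omega> f \<le> 1"
  define g where "g = iter_partial L f"
  have len: "length L + Suc 0 \<le> k" "length (i # L) \<le> k" using assms by auto
  have g: "C_k (Suc 0) g"
    unfolding g_def by (rule C_k_iter_partial[OF C_k_mono[OF Cbw_C_k[OF f(1)] len(1)]])
  \<comment> \<open>Subtracting the linear part reduces the claim to a bound for the derivative of \<open>u\<close>.\<close>
  define u where "u s = g (x + s *\<^sub>R axis i 1) - s * partial i g x" for s
  have "norm (u t - u 0) \<le> delta_modulus TYPE('n) \<bar>t\<bar> * norm (t - 0)"
  proof (rule field_differentiable_bound[where S = "cball 0 \<bar>t\<bar>"])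
    show "(u has_field_derivative partial i g (x + s *\<^sub>R axis i 1) - partial i g x) (at s within cball 0 \<bar>t\<bar>)" for s
      unfolding u_def
      by (rule has_field_derivative_at_within) (auto intro!: derivative_eq_intros C_k_partial_has_derivative[OF g])
    fix s :: real assume s: "s \<in> cball 0 \<bar>t\<bar>"
    show "norm (partial i g (x + s *\<^sub>R axis i 1) - partial i g x) \<le> delta_modulus TYPE('n) \<bar>t\<bar>"
    proof (cases "s = 0")
      case True
      then show ?thesis using delta_modulus_nonneg[where 'n = 'n, of "\<bar>t\<bar>"] assms(2) by simp
    next
      case False
      have "\<bar>iter_partial (i # L) f (x + s *\<^sub>R axis i 1) - iter_partial (i # L) f x\<bar>
          \<le> delta_modulus TYPE('n) (norm (x + s *\<^sub>R axis i 1 - x))"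
        using False by (intro iter_partial_modulus[OF f len(2)]) (simp add: axis_eq_0_iff)
      also have "\<dots> = delta_modulus TYPE('n) \<bar>s\<bar>" by simp
      also have "\<dots> \<le> delta_modulus TYPE('n) \<bar>t\<bar>"
        using s False by (intro delta_modulus_mono) auto
      finally show ?thesis by (simp add: g_def)
    qed
  qed auto
  then have "\<bar>u t - u 0\<bar> / \<bar>t\<bar> \<le> delta_modulus TYPE('n) \<bar>t\<bar>"
    using assms(2) by (simp add: divide_le_eq)
  moreover have "1 * delta_quotient L i x t f + (-1) * iter_delta k \<omega> (i # L) x f = (u t - u 0) / t"
    using f(1) assms(2) by (simp add: delta_quotient_def iter_delta_def u_def g_def field_simps)
  ultimately show "\<bar>1 * delta_quotient L i x t f + (-1) * iter_delta k \<omega> (i # L) x f\<bar> \<le> delta_modulus TYPE('n) \<bar>t\<bar>"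
    by simp
qed

text \<open>
  Each further differentiation is a limit, in the dual norm, of difference quotients of elements that
  already belong to the closed subspace.
\<close>
lemma iter_delta_in_Gbw:
  fixes x :: "real^'n::finite"
  assumes "length L \<le> k"
  shows "iter_delta k \<omega> L x \<in> Gbw k \<omega>"
  using assms
proof (induction L arbitrary: x)
  case Nil
  have "range (delta k \<omega> (\<lambda>_::'n. 0)) \<subseteq> Gbw k \<omega>"
    unfolding Gbw_def by (rule hull_subset)
  then have "delta k \<omega> (\<lambda>_. 0) x \<in> Gbw k \<omega>" by (rule subsetD) (rule rangeI)
  then show ?case by (simp only: delta_0_eq_iter_delta)
next
  case (Cons i L)
  define t where "t m = inverse (real (Suc m))" for m
  have t: "t m > 0" for m by (simp add: t_def)
  have t0: "t \<longlonglongrightarrow> 0" unfolding t_def by (rule LIMSEQ_inverse_real_of_nat)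
  have quot: "delta_quotient L i x (t m) \<in> Gbw k \<omega>" for m
    unfolding delta_quotient_def using Cons.prems
    by (intro closed_subspace_linear_combination[OF Gbw_closed_subspace] Cons.IH) auto
  have "filterlim t (at 0) sequentially"
    unfolding filterlim_at using t0 t by (simp add: less_imp_neq[OF t, symmetric])
  from filterlim_compose[OF delta_modulus_norm_tendsto_0[where x = "0::real"] this]
  have "(\<lambda>m. delta_modulus TYPE('n) \<bar>t m\<bar>) \<longlonglongrightarrow> 0" by simp
  moreover have "norm (Cbw_dual_norm k \<omega> (\<lambda>f. delta_quotient L i x (t m) f - iter_delta k \<omega> (i # L) x f))
      \<le> delta_modulus TYPE('n) \<bar>t m\<bar>" for m
  proof -
    have "(\<lambda>f. 1 * delta_quotient L i x (t m) f + (-1) * iter_delta k \<omega> (i # L) x f) \<in> Cbw_dual k \<omega>"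
      using subsetD[OF Gbw_subset_dual quot] iter_delta_in_dual[OF Cons.prems]
      by (rule closed_subspace_linear_combination[OF dual_space_closed_subspace])
    from dual_norm_nonneg[OF this] show ?thesis
      using dual_norm_delta_quotient_le[of L "t m" i x] t[of m] Cons.prems by simp
  qed
  ultimately have lim: "(\<lambda>m. Cbw_dual_norm k \<omega> (\<lambda>f. delta_quotient L i x (t m) f - iter_delta k \<omega> (i # L) x f)) \<longlonglongrightarrow> 0"
    by - (rule Lim_null_comparison[OF always_eventually], rule allI)
  show ?case
  proof (rule closed_subspaceD(5)[OF Gbw_closed_subspace, where s = "\<lambda>m. delta_quotient L i x (t m)"])
    show "iter_delta k \<omega> (i # L) x \<in> Cbw_dual k \<omega>" by (rule iter_delta_in_dual[OF Cons.prems])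
    show "delta_quotient L i x (t m) \<in> Gbw k \<omega>" for m by (rule quot)
    show "(\<lambda>m. Cbw_dual_norm k \<omega> (\<lambda>f. delta_quotient L i x (t m) f - iter_delta k \<omega> (i # L) x f)) \<longlonglongrightarrow> 0"
      by (rule lim)
  qed
qed

text \<open>
  A bounded functional \<open>\<Phi>\<close> preserves the limits of the difference quotients, so differentiating
  \<open>h\<close> amounts to differentiating \<open>x \<mapsto> \<delta>\<^sub>x\<close> inside \<open>\<Phi>\<close>. The bounds for \<open>h\<close> are those for the
  functionals, multiplied by the norm of \<open>\<Phi>\<close>.
\<close>
lemma functional_of_deltas:
  fixes \<Phi> :: "((real^'n::finite \<Rightarrow> real) \<Rightarrow> real) \<Rightarrow> real"
  assumes \<Phi>: "bounded_linear_on (Gbw k \<omega>) (Cbw_dual_norm k \<omega>) \<Phi>"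
    and M: "\<And>\<phi>. \<phi> \<in> Gbw k \<omega> \<Longrightarrow> \<bar>\<Phi> \<phi>\<bar> \<le> M * Cbw_dual_norm k \<omega> \<phi>" "0 \<le> M"
  defines "h \<equiv> \<lambda>x. \<Phi> (delta k \<omega> (\<lambda>_. 0) x)"
  shows "h \<in> Cbw k \<omega>" "Cbw_norm k \<omega> h \<le> M"
    and "mi_order \<alpha> \<le> k \<Longrightarrow> D \<alpha> h x = \<Phi> (delta k \<omega> \<alpha> x)"
proof -
  note lin = bounded_linear_on_linear_combination[OF Gbw_closed_subspace \<Phi>]
    and comb = closed_subspace_linear_combination[OF Gbw_closed_subspace]
  have diff: "\<bar>\<Phi> \<phi> - \<Phi> \<psi>\<bar> \<le> M * b"
    if "\<phi> \<in> Gbw k \<omega>" "\<psi> \<in> Gbw k \<omega>" "Cbw_dual_norm k \<omega> (\<lambda>f. 1 * \<phi> f + (-1) * \<psi> f) \<le> b" for \<phi> \<psi> b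
  proof -
    have "\<Phi> \<phi> - \<Phi> \<psi> = \<Phi> (\<lambda>f. 1 * \<phi> f + (-1) * \<psi> f)"
      using lin[OF that(1,2), of 1 "-1"] by simp
    also have "\<bar>\<dots>\<bar> \<le> M * Cbw_dual_norm k \<omega> (\<lambda>f. 1 * \<phi> f + (-1) * \<psi> f)"
      by (rule M(1)[OF comb[OF that(1,2)]])
    also have "\<dots> \<le> M * b" using that(3) M(2) by (rule mult_left_mono)
    finally show ?thesis .
  qed
  define e where "e L x = \<Phi> (iter_delta k \<omega> L x)" for L and x :: "real^'n"
  have cont: "continuous_on UNIV (e L)" if "length L \<le> k" for L
  proof -
    have "(e L \<longlongrightarrow> e L x) (at x)" for x
    proof (rule LIM_zero_cancel, rule Lim_null_comparison)
      show "\<forall>\<^sub>F y in at x. norm (e L y - e L x) \<le> M * delta_modulus TYPE('n) (norm (y - x))"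
        unfolding eventually_at_filter e_def real_norm_def
        by (intro always_eventually allI impI diff iter_delta_in_Gbw that dual_norm_iter_delta_diff_le)
      show "((\<lambda>y. M * delta_modulus TYPE('n) (norm (y - x))) \<longlongrightarrow> 0) (at x)"
        by (rule tendsto_mult_right_zero[OF delta_modulus_norm_tendsto_0])
    qed
    then show ?thesis by (simp add: continuous_on_eq_continuous_at isCont_def)
  qed
  have deriv: "((\<lambda>t. e L (x + t *\<^sub>R axis i 1)) has_real_derivative e (i # L) x) (at 0)"
    if "length L < k" for L i x
  proof -
    have G: "iter_delta k \<omega> L y \<in> Gbw k \<omega>" "iter_delta k \<omega> (i # L) y \<in> Gbw k \<omega>" for y
      using that by (auto intro: iter_delta_in_Gbw)
    have quot_eq: "delta_quotient L i x t =
        (\<lambda>f. (1 / t) * iter_delta k \<omega> L (x + t *\<^sub>R axis i 1) f + (- 1 / t) * iter_delta k \<omega> L x f)" for t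
      by (rule ext) (rule delta_quotient_def)
    have quot: "delta_quotient L i x t \<in> Gbw k \<omega>" "\<Phi> (delta_quotient L i x t) = (e L (x + t *\<^sub>R axis i 1) - e L x) / t" for t
    proof -
      show "delta_quotient L i x t \<in> Gbw k \<omega>"
        unfolding quot_eq by (rule comb[OF G(1) G(1)])
      have "\<Phi> (delta_quotient L i x t) = (1 / t) *\<^sub>R e L (x + t *\<^sub>R axis i 1) + (- 1 / t) *\<^sub>R e L x"
        unfolding quot_eq e_def by (rule lin[OF G(1) G(1)])
      then show "\<Phi> (delta_quotient L i x t) = (e L (x + t *\<^sub>R axis i 1) - e L x) / t"
        by (simp add: diff_divide_distrib)
    qed
    have "((\<lambda>t. (e L (x + t *\<^sub>R axis i 1) - e L x) / t) \<longlongrightarrow> e (i # L) x) (at 0)"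
    proof (rule LIM_zero_cancel, rule Lim_null_comparison)
      have "norm ((e L (x + t *\<^sub>R axis i 1) - e L x) / t - e (i # L) x) \<le> M * delta_modulus TYPE('n) (norm (t - 0))"
        if "t \<noteq> 0" for t
      proof -
        have "\<bar>\<Phi> (delta_quotient L i x t) - \<Phi> (iter_delta k \<omega> (i # L) x)\<bar> \<le> M * delta_modulus TYPE('n) \<bar>t\<bar>"
          by (intro diff quot(1) G(2) dual_norm_delta_quotient_le[OF \<open>length L < k\<close> that])
        then show ?thesis by (simp add: quot(2) e_def)
      qed
      then show "\<forall>\<^sub>F t in at 0. norm ((e L (x + t *\<^sub>R axis i 1) - e L x) / t - e (i # L) x)
          \<le> M * delta_modulus TYPE('n) (norm (t - 0))"
        unfolding eventually_at_filter by (intro always_eventually) blast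
      show "((\<lambda>t::real. M * delta_modulus TYPE('n) (norm (t - 0))) \<longlongrightarrow> 0) (at 0)"
        by (rule tendsto_mult_right_zero[OF delta_modulus_norm_tendsto_0])
    qed
    then show ?thesis by (simp add: DERIV_def)
  qed
  have partial_e: "partial i (e L) = e (i # L)" if "length L < k" for i L
    by (rule ext) (rule partial_eqI[OF deriv[OF that]])
  have C_k_e: "C_k m (e L)" if "m + length L \<le> k" for m L
    using that
  proof (induction m arbitrary: L)
    case (Suc m)
    have L: "length L < k" "length L \<le> k" using Suc.prems by auto
    have "(\<lambda>t. e L (x + t *\<^sub>R axis i 1)) field_differentiable at 0" for i x
      using deriv[OF L(1)] unfolding field_differentiable_def by blast
    moreover have "C_k m (partial i (e L))" for i
      unfolding partial_e[OF L(1)] using Suc.prems by (intro Suc.IH) simp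
    ultimately show ?case using cont[OF L(2)] by simp
  qed (simp add: cont)
  have iter: "iter_partial L h = e L" if "length L \<le> k" for L
    using that
  proof (induction L)
    case Nil
    show ?case by (simp add: h_def e_def fun_eq_iff delta_0_eq_iter_delta)
  next
    case (Cons i L)
    then show ?case using partial_e[of L i] by simp
  qed
  have "C_k k h" using C_k_e[of k "[]"] iter[of "[]"] by simp
  moreover have "Cbw_bound k \<omega> M h"
    unfolding Cbw_bound_def
  proof (intro conjI allI impI)
    fix L :: "'n list" and x :: "real^'n" assume L: "length L \<le> k"
    have "\<bar>e L x\<bar> \<le> M * Cbw_dual_norm k \<omega> (iter_delta k \<omega> L x)"
      unfolding e_def by (rule M(1)[OF iter_delta_in_Gbw[OF L]])
    also have "\<dots> \<le> M * 1" by (intro mult_left_mono M dual_norm_iter_delta_le L)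
    finally show "\<bar>iter_partial L h x\<bar> \<le> M" by (simp add: iter L)
  next
    fix L :: "'n list" and x y :: "real^'n" assume L: "length L = k" and "x \<noteq> y"
    have "\<bar>e L x - e L y\<bar> \<le> M * \<omega> (norm (x - y))"
      unfolding e_def
      by (intro diff iter_delta_in_Gbw dual_norm_iter_delta_diff_top_order_le[OF L \<open>x \<noteq> y\<close>]) (simp_all add: L)
    then show "\<bar>iter_partial L h x - iter_partial L h y\<bar> \<le> M * \<omega> (norm (x - y))"
      by (simp add: iter L)
  qed
  ultimately show "h \<in> Cbw k \<omega>" "Cbw_norm k \<omega> h \<le> M" by (rule CbwI)+
  show "D \<alpha> h x = \<Phi> (delta k \<omega> \<alpha> x)" if "mi_order \<alpha> \<le> k"
    using that by (simp add: D_eq_iter_partial delta_eq_iter_delta iter length_index_list e_def)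
qed

end


section \<open>Series representation of operators on the predual\<close>

theorem theorem1p10:
  fixes k :: nat and \<omega> :: "real \<Rightarrow> real" and lam :: real
  assumes "modulus_of_continuity \<omega>"
    and "\<exists>x::'x::banach. x \<noteq> 0"
    and "separable_space (euclidean :: 'x topology)"
    and "1 \<le> lam"
    and "approximation_property lam TYPE('x)"
  shows "\<exists>v :: nat \<Rightarrow> 'x. (\<forall>j. norm (v j) = 1) \<and>
    (\<forall>H :: ((real^'n::finite \<Rightarrow> real) \<Rightarrow> real) \<Rightarrow> 'x.
       bounded_linear_on (Gbw k \<omega>) (Cbw_dual_norm k \<omega>) H \<longrightarrow>
       (\<exists>h :: nat \<Rightarrow> real^'n \<Rightarrow> real.
          (\<forall>j. h j \<in> Cbw k \<omega> \<and>
               Cbw_norm k \<omega> (h j) \<le> 32 * lam\<^sup>2 * op_norm (Gbw k \<omega>) (Cbw_dual_norm k \<omega>) H) \<and>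
          (\<forall>x \<alpha>. mi_order \<alpha> \<le> k \<longrightarrow>
             (\<lambda>j. D \<alpha> (h j) x *\<^sub>R v j) sums H (delta k \<omega> \<alpha> x))))"
proof -
  obtain v :: "nat \<Rightarrow> 'x" and g where v: "\<And>j. norm (v j) = 1" and lin: "\<And>j. linear (g j)"
    and g: "\<And>j y. \<bar>g j y\<bar> \<le> 2 * lam * norm y" and frame: "\<And>y. (\<lambda>j. g j y *\<^sub>R v j) sums y"
    using approximation_property_imp_frame[OF assms(2,3,5)] by blast
  have "\<exists>h :: nat \<Rightarrow> real^'n \<Rightarrow> real.
      (\<forall>j. h j \<in> Cbw k \<omega> \<and>
        Cbw_norm k \<omega> (h j) \<le> 32 * lam\<^sup>2 * op_norm (Gbw k \<omega>) (Cbw_dual_norm k \<omega>) H) \<and>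
      (\<forall>x \<alpha>. mi_order \<alpha> \<le> k \<longrightarrow> (\<lambda>j. D \<alpha> (h j) x *\<^sub>R v j) sums H (delta k \<omega> \<alpha> x))"
    if H: "bounded_linear_on (Gbw k \<omega>) (Cbw_dual_norm k \<omega>) H"
    for H :: "((real^'n \<Rightarrow> real) \<Rightarrow> real) \<Rightarrow> 'x"
  proof -
    define N where "N = op_norm (Gbw k \<omega>) (Cbw_dual_norm k \<omega>) H"
    define M where "M = 2 * lam * N"
    note G = Gbw_closed_subspace[OF assms(1), of k, where 'n = 'n]
    have nonneg: "0 \<le> Cbw_dual_norm k \<omega> \<phi>" if "\<phi> \<in> Gbw k \<omega>" for \<phi> :: "(real^'n \<Rightarrow> real) \<Rightarrow> real"
      by (rule dual_norm_nonneg[OF assms(1) subsetD[OF Gbw_subset_dual[OF assms(1)] that]])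
    have HN: "norm (H \<phi>) \<le> N * Cbw_dual_norm k \<omega> \<phi>" if "\<phi> \<in> Gbw k \<omega>" for \<phi>
      unfolding N_def
    proof (rule norm_le_op_norm[OF H nonneg _ _ that])
      show "(\<lambda>f. c * \<phi> f) \<in> Gbw k \<omega>" for c by (rule closed_subspaceD(4)[OF G that])
      show "Cbw_dual_norm k \<omega> (\<lambda>f. c * \<phi> f) \<le> \<bar>c\<bar> * Cbw_dual_norm k \<omega> \<phi>" for c
        by (rule dual_norm_scale_le[OF assms(1) subsetD[OF Gbw_subset_dual[OF assms(1)] that]])
    qed
    have "norm (H (\<lambda>_. 0)) \<le> N"
      unfolding N_def
    proof (rule norm_le_op_norm_unit_ball[OF H nonneg closed_subspaceD(2)[OF G]])
      show "Cbw_dual_norm k \<omega> (\<lambda>_::real^'n \<Rightarrow> real. 0) \<le> 1"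
        by (rule dual_norm_le[OF assms(1)]) simp
    qed
    then have "0 \<le> N" by (rule order_trans[OF norm_ge_zero])
    then have "0 \<le> M" using assms(4) by (simp add: M_def)
    have "2 * lam \<le> 32 * lam\<^sup>2"
      using assms(4) mult_right_mono[of 1 lam lam] by (simp add: power2_eq_square)
    then have M: "M \<le> 32 * lam\<^sup>2 * N"
      unfolding M_def using \<open>0 \<le> N\<close> by (rule mult_right_mono)
    have bound: "\<bar>g j (H \<phi>)\<bar> \<le> M * Cbw_dual_norm k \<omega> \<phi>" if "\<phi> \<in> Gbw k \<omega>" for j \<phi>
    proof -
      have "\<bar>g j (H \<phi>)\<bar> \<le> 2 * lam * norm (H \<phi>)" by (rule g)
      also have "\<dots> \<le> 2 * lam * (N * Cbw_dual_norm k \<omega> \<phi>)"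
        using HN[OF that] assms(4) by (intro mult_left_mono) auto
      finally show ?thesis by (simp add: M_def mult.assoc)
    qed
    have gH: "bounded_linear_on (Gbw k \<omega>) (Cbw_dual_norm k \<omega>) (\<lambda>\<phi>. g j (H \<phi>))" for j
      unfolding bounded_linear_on_def[of _ _ "\<lambda>\<phi>. g j (H \<phi>)"]
    proof (intro conjI ballI allI)
      show "g j (H (\<lambda>f. \<phi> f + \<psi> f)) = g j (H \<phi>) + g j (H \<psi>)" if "\<phi> \<in> Gbw k \<omega>" "\<psi> \<in> Gbw k \<omega>" for \<phi> \<psi>
        by (simp only: bounded_linear_onD(1)[OF H that] linear_add[OF lin])
      show "g j (H (\<lambda>f. c * \<phi> f)) = c *\<^sub>R g j (H \<phi>)" if "\<phi> \<in> Gbw k \<omega>" for c \<phi>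
        by (simp only: bounded_linear_onD(2)[OF H that] linear_scale[OF lin])
      show "\<exists>K. \<forall>\<phi>\<in>Gbw k \<omega>. norm (g j (H \<phi>)) \<le> K * Cbw_dual_norm k \<omega> \<phi>"
        using bound by (intro exI[of _ M]) simp
    qed
    define h where "h j x = g j (H (delta k \<omega> (\<lambda>_. 0) x))" for j and x :: "real^'n"
    have h: "h j \<in> Cbw k \<omega>" "Cbw_norm k \<omega> (h j) \<le> M"
      "mi_order \<alpha> \<le> k \<Longrightarrow> D \<alpha> (h j) x = g j (H (delta k \<omega> \<alpha> x))" for j \<alpha> x
      using functional_of_deltas[OF assms(1) gH[of j] bound \<open>0 \<le> M\<close>]
      unfolding h_def[abs_def] by blast+
    show ?thesis
    proof (intro exI[of _ h] conjI allI impI)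
      show "h j \<in> Cbw k \<omega>" for j by (rule h(1))
      show "Cbw_norm k \<omega> (h j) \<le> 32 * lam\<^sup>2 * op_norm (Gbw k \<omega>) (Cbw_dual_norm k \<omega>) H" for j
        using h(2)[of j] M unfolding N_def by linarith
      show "(\<lambda>j. D \<alpha> (h j) x *\<^sub>R v j) sums H (delta k \<omega> \<alpha> x)" if "mi_order \<alpha> \<le> k" for x \<alpha>
        unfolding h(3)[OF that] by (rule frame)
    qed
  qed
  then show ?thesis using v by blast
qed

end
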